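(* Let $(Z_n)_{n\ge0}$ be the single-unit process of the context with $$f(x)=(1-\theta)+(2\theta-1)(3x^2-2x^3),\qquad\theta\in(1/2,1).$$ Call the system predictable if there is a deterministic point $z_\infty$ such that $Z_n\to z_\infty$ almost surely. If $1/2<\theta\le5/6$, then the system is predictable and the unique limit configuration is $1/2$, i.e. $Z_n\to1/2$ almost surely. Otherwise, i.e. if $5/6<\theta<1$, $Z_n$ converges almost surely, but the system is not predictable, and the two possible limit configurations (values of the almost sure limit) $z_1^*,z_2^*$ belong to $(0,1)\setminus\{1/2\}$ and are such that $$0<z_1^*<\widehat x_1<\tfrac12\qquad\text{and}\qquad\tfrac12<\widehat x_2=1-\widehat x_1<z_2^*=1-z_1^*<1,$$ where $\widehat x_1<1/2<\widehat x_2$ are the solutions in $(0,1)$ of $f'=1$.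
   Context: Single-unit process (case $N=1$, $\alpha=\beta=0$): $(r_n)_{n\ge0}$ is a deterministic sequence in $[0,1]$ with $\lim_{n\to\infty}nr_n=1$; $Z_0$ is a random variable with values in $[0,1]$; for $n\ge0$, $Z_{n+1}=(1-r_n)Z_n+r_nI_{n+1}$ with $I_{n+1}\in\{0,1\}$ and $P(I_{n+1}=1\mid\mathcal{F}_n)=f(Z_n)$, where $\mathcal{F}_n=\sigma(Z_0,I_1,\dots,I_n)$. *)

theory Defs
  imports "HOL-Probability.Probability"
begin

definition f_theta :: "real \<Rightarrow> real \<Rightarrow> real" where
  "f_theta \<theta> x = (1 - \<theta>) + (2 * \<theta> - 1) * (3 * x^2 - 2 * x^3)"

(* Only the space and the measurable sets of this measure matter: it serves as the
   subalgebra argument of real_cond_exp. The variable I 0 does not enter. *)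
definition past :: "'a measure \<Rightarrow> (nat \<Rightarrow> 'a \<Rightarrow> real) \<Rightarrow> (nat \<Rightarrow> 'a \<Rightarrow> real) \<Rightarrow> nat \<Rightarrow> 'a measure" where
  "past M Z I n = sigma (space M)
     ({Z 0 -` A \<inter> space M | A. A \<in> sets borel} \<union>
      {I i -` A \<inter> space M | i A. i \<in> {1..n} \<and> A \<in> sets borel})"

locale single_unit_process = prob_space M
  for M :: "'a measure"
    and r :: "nat \<Rightarrow> real"
    and f :: "real \<Rightarrow> real"
    and Z :: "nat \<Rightarrow> 'a \<Rightarrow> real"
    and I :: "nat \<Rightarrow> 'a \<Rightarrow> real" +
  assumes r_range: "r n \<in> {0..1}"
    and r_lim: "(\<lambda>n. real n * r n) \<longlonglongrightarrow> 1"
    and Z0_measurable: "random_variable borel (Z 0)"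
    and Z0_range: "\<omega> \<in> space M \<Longrightarrow> Z 0 \<omega> \<in> {0..1}"
    and I_measurable: "random_variable borel (I (Suc n))"
    and I_range: "\<omega> \<in> space M \<Longrightarrow> I (Suc n) \<omega> \<in> {0, 1}"
    and Z_step: "\<omega> \<in> space M \<Longrightarrow> Z (Suc n) \<omega> = (1 - r n) * Z n \<omega> + r n * I (Suc n) \<omega>"
    and I_cond: "AE \<omega> in M.
          real_cond_exp M (past M Z I n) (indicator {\<omega> \<in> space M. I (Suc n) \<omega> = 1}) \<omega> = f (Z n \<omega>)"

definition predictable :: "'a measure \<Rightarrow> (nat \<Rightarrow> 'a \<Rightarrow> real) \<Rightarrow> bool" where
  "predictable M Z \<longleftrightarrow> (\<exists>z. AE \<omega> in M. (\<lambda>n. Z n \<omega>) \<longlonglongrightarrow> z)"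

(* The values taken with positive probability by the limit. This describes the law of the
   limit completely only together with the statement that almost surely the limit
   exists and belongs to this set. *)
definition limit_configurations :: "'a measure \<Rightarrow> (nat \<Rightarrow> 'a \<Rightarrow> real) \<Rightarrow> real set" where
  "limit_configurations M Z = {z. measure M {\<omega> \<in> space M. (\<lambda>n. Z n \<omega>) \<longlonglongrightarrow> z} > 0}"

end

theory Submission
  imports Defs
begin

text \<open>The process is a noisy Euler scheme for \<open>x' = f x - x\<close>: the martingale formed by the noise
  converges by a maximal inequality, so \<open>Z\<close> converges to a fixed point of \<open>f\<close>. For
  \<open>\<theta> \<le> 5/6\<close> the only fixed point is \<open>1/2\<close>. For \<open>\<theta> > 5/6\<close> there are two more, \<open>1/2 \<plusminus> u\<close>, with
  drift away from \<open>1/2\<close> in between. There the mean of \<open>1 / (1 + \<kappa> n (Z\<^sub>n - 1/2)\<^sup>2)\<close> contracts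
  by \<open>1 - q/n\<close> at each step and hence vanishes, so that \<open>sqrt n \<bar>Z\<^sub>n - 1/2\<bar>\<close> tends to infinity
  in probability; from distance \<open>K / sqrt n\<close> the process returns with probability only
  \<open>O(1/K\<^sup>2)\<close>, which excludes the limit \<open>1/2\<close>. Both other limits occur, because a long
  initial run of equal \<open>I\<close> has positive probability and brings \<open>Z\<close> beyond a stable point at a time
  when a return is unlikely.\<close>

section \<open>Deterministic recursions\<close>

text \<open>The threshold is where the slope of \<open>f_theta\<close> at \<open>1/2\<close>, namely
  \<open>3 * (2*\<theta> - 1) / 2\<close>, passes \<open>1\<close>; this happens exactly at
  \<open>\<theta> = 5/6\<close>. The obstacle above the threshold is the limit \<open>1/2\<close>:
  as \<open>r n\<close> is close to \<open>1/n\<close>, the noise still to come after time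
  \<open>n\<close> has size of order \<open>1 / sqrt n\<close>, so an escape must be measured on
  that scale, and linear instability alone gives nothing at the point itself. Since
  \<open>n * r n\<close> tends to \<open>1\<close> without any known rate, the estimates use only
  fixed bounds on it, such as \<open>1/2\<close> and \<open>9/8\<close>. Writing the drift as
  \<open>y * w\<close> with \<open>y = Z - 1/2\<close>, the quantity \<open>n * y^2\<close> grows in
  mean at relative rate about \<open>(1 + 2 * w) / n\<close>. On all of \<open>[0,1]\<close> one has
  \<open>w \<ge> 2 * \<theta> - 2 > - 1/3\<close>, so this rate is positive even beyond the stable
  points and a single test function serves globally. At \<open>y = 0\<close> the push comes from the
  conditional variance of the noise, which is at least \<open>(1 - \<theta>)^2\<close> times the
  squared step size.\<close>

lemma f_theta_centered:
  "f_theta \<theta> (1/2 + y) - 1/2 - y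
     = y * ((3 * (2*\<theta> - 1) / 2 - 1) - 2 * (2*\<theta> - 1) * y\<^sup>2)"
  unfolding f_theta_def by (simp add: algebra_simps power2_eq_square power3_eq_cube)

text \<open>The cubic \<open>3 * x^2 - 2 * x^3\<close> maps \<open>[0,1]\<close> into itself. The
  bounds give both outcomes of each \<open>I\<close> conditional probability at least
  \<open>1 - \<theta>\<close>, which keeps the noise variance away from zero and makes every finite
  run of equal outcomes possible.\<close>

lemma f_theta_bounds:
  assumes "1/2 < \<theta>" "0 \<le> x" "x \<le> 1"
  shows "1 - \<theta> \<le> f_theta \<theta> x" "f_theta \<theta> x \<le> \<theta>"
proof -
  have *: "3 * x^2 - 2 * x^3 = x\<^sup>2 * (3 - 2*x)" "1 - (3 * x^2 - 2 * x^3) = (1-x)\<^sup>2 * (1 + 2*x)"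
    by (simp_all add: algebra_simps power2_eq_square power3_eq_cube)
  have "0 \<le> x\<^sup>2 * (3 - 2*x)" "0 \<le> (1-x)\<^sup>2 * (1 + 2*x)" using assms by simp_all
  then have "0 \<le> 3 * x^2 - 2 * x^3" "3 * x^2 - 2 * x^3 \<le> 1" using * by linarith+
  then have "0 \<le> (2*\<theta>-1) * (3 * x^2 - 2 * x^3)"
    "(2*\<theta>-1) * (3 * x^2 - 2 * x^3) \<le> 2*\<theta>-1"
    using assms(1) by (auto intro: mult_left_le)
  then show "1 - \<theta> \<le> f_theta \<theta> x" "f_theta \<theta> x \<le> \<theta>"
    unfolding f_theta_def by auto
qed

lemma not_summable_of_n_times_tendsto_1:
  fixes r :: "nat \<Rightarrow> real"
  assumes "(\<lambda>n. real n * r n) \<longlonglongrightarrow> 1"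
  shows "\<not> summable r"
proof
  assume "summable r"
  have "eventually (\<lambda>n. 1/2 < real n * r n) sequentially"
    using assms by (rule order_tendstoD) simp
  then have "eventually (\<lambda>n. norm (1 / real n) \<le> 2 * r n) sequentially"
    using eventually_gt_at_top[of 0]
    by eventually_elim (simp add: field_simps)
  then have "summable (\<lambda>n. 1 / real n)"
    using summable_comparison_test_ev summable_mult[OF \<open>summable r\<close>] by fast
  then show False
    using not_summable_harmonic[where 'a = real] by (simp add: inverse_eq_divide)
qed

lemma tendsto_0_of_n_times_tendsto:
  fixes r :: "nat \<Rightarrow> real"
  assumes "(\<lambda>n. real n * r n) \<longlonglongrightarrow> c"
  shows "r \<longlonglongrightarrow> 0"
proof -
  have "(\<lambda>n. (real n * r n) * (1 / real n)) \<longlonglongrightarrow> c * 0"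
    by (intro tendsto_mult assms lim_1_over_n)
  moreover have "eventually (\<lambda>n. (real n * r n) * (1 / real n) = r n) sequentially"
    using eventually_gt_at_top[of 0] by eventually_elim simp
  ultimately show ?thesis by (simp add: tendsto_cong)
qed

text \<open>A small step size cannot carry the sequence downwards across a point at which the drift is
  positive.\<close>

lemma eventually_one_side:
  fixes x w r :: "nat \<Rightarrow> real" and g :: "real \<Rightarrow> real"
  assumes step: "\<And>n. w (Suc n) = w n + r n * g (x n)"
    and r: "\<And>n. 0 \<le> r n"
    and rg: "(\<lambda>n. r n * g (x n)) \<longlonglongrightarrow> 0"
    and wx: "(\<lambda>n. w n - x n) \<longlonglongrightarrow> 0"
    and g: "isCont g p" "g p > 0"
  shows "eventually (\<lambda>n. p \<le> w n) sequentially \<or> eventually (\<lambda>n. w n \<le> p) sequentially"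
proof -
  have "eventually (\<lambda>y. 0 < g y) (at p)"
    using g by (auto simp: isCont_def dest: order_tendstoD(1))
  then obtain \<delta> where \<delta>: "\<delta> > 0" and "\<And>y. y \<noteq> p \<Longrightarrow> dist y p < \<delta> \<Longrightarrow> 0 < g y"
    by (auto simp: eventually_at)
  with g have pos: "\<And>y. \<bar>y - p\<bar> < \<delta> \<Longrightarrow> 0 < g y" by (metis dist_real_def)
  have "eventually (\<lambda>n. \<bar>r n * g (x n)\<bar> < \<delta>/2 \<and> \<bar>w n - x n\<bar> < \<delta>/2) sequentially"
    using tendstoD[OF rg, of "\<delta>/2"] tendstoD[OF wx, of "\<delta>/2"] \<delta>
    by (auto simp: dist_real_def elim: eventually_elim2)
  then obtain N where N: "\<And>n. n \<ge> N \<Longrightarrow> \<bar>r n * g (x n)\<bar> < \<delta>/2 \<and> \<bar>w n - x n\<bar> < \<delta>/2"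
    by (auto simp: eventually_sequentially)
  \<comment> \<open>If \<open>w n\<close> is within \<open>\<delta>/2\<close> above
    \<open>p\<close>, then \<open>x n\<close> is within \<open>\<delta>\<close> of \<open>p\<close>,
    where the drift is positive; if it is farther up, one increment is too short to reach
    \<open>p\<close>.\<close>
  have stay: "p \<le> w (Suc n)" if "n \<ge> N" "p \<le> w n" for n
  proof (cases "w n < p + \<delta>/2")
    case True
    then have "\<bar>x n - p\<bar> < \<delta>" using N[OF that(1)] that(2) by (auto simp: abs_if split: if_splits)
    then have "0 \<le> r n * g (x n)" using pos r by (simp add: less_imp_le)
    then show ?thesis using that step by simp
  next
    case False
    then show ?thesis using N[OF that(1)] step[of n] by (auto simp: abs_if split: if_splits)
  qed
  show ?thesis
  proof (cases "\<exists>m\<ge>N. p \<le> w m")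
    case True
    then obtain m where m: "m \<ge> N" "p \<le> w m" by blast
    have "p \<le> w n" if "n \<ge> m" for n
      using that by (induction n rule: dec_induct) (use m stay in auto)
    then show ?thesis by (auto simp: eventually_sequentially)
  next
    case False
    then have "\<forall>n\<ge>N. w n \<le> p" by (meson linear)
    then show ?thesis by (auto simp: eventually_sequentially)
  qed
qed

text \<open>Removing the convergent perturbation leaves a sequence \<open>w\<close> with the same
  asymptotics as \<open>x\<close> and vanishing increments. It settles on one side of every point
  where \<open>g\<close> is nonzero, and every interval contains such points, so \<open>w\<close>
  cannot oscillate. At a limit with \<open>g l \<noteq> 0\<close> the increments would have constant
  sign and be comparable to \<open>r\<close>, which is not summable.\<close>

lemma perturbed_euler_scheme_converges:
  fixes x s r :: "nat \<Rightarrow> real" and g :: "real \<Rightarrow> real"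
  assumes step: "\<And>n. x (Suc n) - s (Suc n) = x n - s n + r n * g (x n)"
    and s: "convergent s"
    and x: "\<And>n. 0 \<le> x n" "\<And>n. x n \<le> 1"
    and r: "\<And>n. 0 \<le> r n" "r \<longlonglongrightarrow> 0" "\<not> summable r"
    and g: "\<And>y. isCont g y" "finite {y. g y = 0}"
  shows "\<exists>z. g z = 0 \<and> x \<longlonglongrightarrow> z"
proof -
  obtain L where L: "s \<longlonglongrightarrow> L" using s by (auto simp: convergent_def)
  define w where "w n = x n - s n + L" for n
  have w_step: "w (Suc n) = w n + r n * g (x n)" for n using step[of n] by (simp add: w_def)
  have wx: "(\<lambda>n. w n - x n) \<longlonglongrightarrow> 0"
    using tendsto_diff[OF tendsto_const[of L] L] by (simp add: w_def)
  have "\<exists>B. \<forall>y. 0 \<le> y \<and> y \<le> 1 \<longrightarrow> norm (g y) \<le> B"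
    using g(1) by (intro isCont_bounded) (auto simp: continuous_at_imp_continuous_on)
  then obtain B where B: "\<And>n. norm (g (x n)) \<le> B" using x by auto
  have "(\<lambda>n. r n * B) \<longlonglongrightarrow> 0" using tendsto_mult_right[OF r(2), of B] by simp
  then have rg: "(\<lambda>n. r n * g (x n)) \<longlonglongrightarrow> 0"
    by (rule Lim_null_comparison[rotated])
       (use B r(1) in \<open>auto simp: abs_mult intro!: always_eventually mult_left_mono\<close>)
  have side: "eventually (\<lambda>n. p \<le> w n) sequentially \<or> eventually (\<lambda>n. w n \<le> p) sequentially"
    if "g p \<noteq> 0" for p
  proof (cases "g p > 0")
    case True
    show ?thesis
      by (rule eventually_one_side[of w r g x]) (use w_step r rg wx g True in auto)
  next
    case False
    \<comment> \<open>Reflection at the origin turns a negative drift at \<open>p\<close> into a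
      positive one at \<open>- p\<close>.\<close>
    have "eventually (\<lambda>n. - p \<le> - w n) sequentially \<or> eventually (\<lambda>n. - w n \<le> - p) sequentially"
    proof (rule eventually_one_side[of "\<lambda>n. - w n" r "\<lambda>y. - g (- y)" "\<lambda>n. - x n" "- p"])
      show "(\<lambda>n. r n * - g (- (- x n))) \<longlonglongrightarrow> 0" using tendsto_minus[OF rg] by simp
      show "(\<lambda>n. - w n - - x n) \<longlonglongrightarrow> 0" using tendsto_minus[OF wx] by simp
      show "isCont (\<lambda>y. - g (- y)) (- p)"
        using isCont_o2[of "- p" uminus g] g(1) by (simp add: isCont_minus)
    qed (use w_step r that False in auto)
    then show ?thesis by auto
  qed
  obtain K where K: "\<And>n. \<bar>s n\<bar> \<le> K"
    using convergent_imp_Bseq[OF s] by (auto simp: Bseq_def)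
  have w_le: "w n \<le> 1 + K + L" and w_ge: "L - K \<le> w n" for n
    using K[of n] x[of n] by (auto simp: w_def abs_le_iff)
  \<comment> \<open>\<open>Sup U\<close> is the lower limit of \<open>w\<close>; it remains to see
    that \<open>w\<close> eventually stays below every larger number.\<close>
  define U where "U = {p. eventually (\<lambda>n. p \<le> w n) sequentially}"
  have U_ne: "L - K \<in> U" using w_ge by (simp add: U_def)
  have U_bdd: "bdd_above U"
  proof (rule bdd_aboveI)
    fix p assume "p \<in> U"
    then obtain n where "p \<le> w n" by (auto simp: U_def eventually_sequentially)
    then show "p \<le> 1 + K + L" using w_le[of n] by simp
  qed
  define l where "l = Sup U"
  have w_lim: "w \<longlonglongrightarrow> l"
  proof (rule order_tendstoI)
    fix p assume "p < l"
    then obtain p' where "p' \<in> U" "p < p'" unfolding l_def using less_cSup_iff U_ne U_bdd by blast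
    then show "eventually (\<lambda>n. p < w n) sequentially"
      by (auto simp: U_def elim: eventually_mono)
  next
    fix p assume "l < p"
    then have "infinite ({l<..<p} - {y. g y = 0})" using g(2) by (simp add: infinite_Ioo)
    then have "{l<..<p} - {y. g y = 0} \<noteq> {}" by (rule infinite_imp_nonempty)
    then obtain p' where "p' \<in> {l<..<p} - {y. g y = 0}" by (meson ex_in_conv)
    then have p': "l < p'" "p' < p" "g p' \<noteq> 0" by auto
    have "p' \<notin> U" using p'(1) cSup_upper[OF _ U_bdd] unfolding l_def by force
    with side[OF p'(3)] have "eventually (\<lambda>n. w n \<le> p') sequentially" by (auto simp: U_def)
    then show "eventually (\<lambda>n. w n < p) sequentially"
      using p'(2) by (auto elim: eventually_mono)
  qed
  have x_lim: "x \<longlonglongrightarrow> l" using tendsto_diff[OF w_lim wx] by simp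
  have "g l = 0"
  proof (rule ccontr)
    assume gl: "g l \<noteq> 0"
    \<comment> \<open>Dividing by \<open>g l\<close> treats both signs at once: the telescoping
      increments of \<open>w\<close>, scaled by \<open>2 / g l\<close>, dominate
      \<open>r\<close>.\<close>
    have "(\<lambda>n. g (x n) / g l) \<longlonglongrightarrow> g l / g l"
      using gl by (intro tendsto_divide isCont_tendsto_compose[OF g(1)] x_lim tendsto_const)
    then have "eventually (\<lambda>n. 1/2 < g (x n) / g l) sequentially"
      using gl by (auto dest!: order_tendstoD(1)[of _ _ _ "1/2"])
    then have ev: "eventually (\<lambda>n. norm (r n) \<le> 2 / g l * (w (Suc n) - w n)) sequentially"
    proof eventually_elim
      case (elim n)
      then have "r n * (1/2) \<le> r n * (g (x n) / g l)" using r(1) by (intro mult_left_mono) auto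
      then show ?case using r(1)[of n] w_step[of n] by (simp add: field_simps)
    qed
    have "summable (\<lambda>n. w (Suc n) - w n)" using telescope_summable[OF w_lim] .
    from summable_comparison_test_ev[OF ev summable_mult[OF this]] r(3) show False by blast
  qed
  with x_lim show ?thesis by blast
qed

text \<open>The sequence is decreasing from \<open>N\<close> on. A positive limit \<open>l\<close>
  would make every decrement at least \<open>q * l / n\<close>, so the telescoping sum of decrements
  would dominate the harmonic series.\<close>

lemma tendsto_0_of_contraction_rate:
  fixes e :: "nat \<Rightarrow> real"
  assumes nonneg: "\<And>n. 0 \<le> e n" and q: "0 < q"
    and rec: "\<And>n. n \<ge> N \<Longrightarrow> e (Suc n) \<le> (1 - q / real n) * e n"
  shows "e \<longlonglongrightarrow> 0"
proof -
  have gain: "q / real n * e n \<le> e n - e (Suc n)" if "n \<ge> N" for n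
    using rec[OF that] by (simp add: algebra_simps)
  have dec: "e (Suc n) \<le> e n" if "n \<ge> N" for n
  proof -
    have "0 \<le> q / real n * e n" using q nonneg by simp
    then show ?thesis using gain[OF that] by linarith
  qed
  have "decseq (\<lambda>n. e (n + N))" using dec by (intro decseq_SucI) simp
  then obtain l where l: "(\<lambda>n. e (n + N)) \<longlonglongrightarrow> l" "\<And>n. l \<le> e (n + N)"
    using decseq_convergent[of "\<lambda>n. e (n + N)" 0] nonneg by auto
  have lim: "e \<longlonglongrightarrow> l" using l(1) by (rule LIMSEQ_offset)
  have "l \<ge> 0" using lim nonneg by (intro LIMSEQ_le_const) auto
  moreover have "\<not> l > 0"
  proof
    assume "l > 0"
    have "summable (\<lambda>n. e n - e (Suc n))" using telescope_summable'[OF lim] .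
    then have "summable (\<lambda>n. 1 / (q * l) * (e n - e (Suc n)))" by (rule summable_mult)
    moreover have "eventually (\<lambda>n. norm (1 / real n) \<le> 1 / (q * l) * (e n - e (Suc n))) sequentially"
      using eventually_ge_at_top[of N]
    proof eventually_elim
      case (elim n)
      have "q / real n * l \<le> q / real n * e n"
        using q l(2)[of "n - N"] elim by (intro mult_left_mono) auto
      then have "q / real n * l \<le> e n - e (Suc n)" using gain[OF elim] by linarith
      then show ?case using q \<open>l > 0\<close> by (simp add: field_simps)
    qed
    ultimately have "summable (\<lambda>n. 1 / real n)" by (rule summable_comparison_test_ev[rotated])
    then show False
      using not_summable_harmonic[where 'a = real] by (simp add: inverse_eq_divide)
  qed
  ultimately show ?thesis using lim by simp
qed

section \<open>A maximal inequality\<close>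

text \<open>Doob's inequality for nonnegative supermartingales in a stopped form: the mean has to
  decrease only on the part of \<open>E\<close> where the level \<open>c\<close> has not been
  reached up to time \<open>k\<close>. This admits Lyapunov functions whose drift has the right sign
  only below the level.\<close>

lemma (in prob_space) maximal_inequality:
  fixes V :: "nat \<Rightarrow> 'a \<Rightarrow> real"
  assumes E[measurable]: "E \<in> events"
    and V[measurable]: "\<And>k. V k \<in> borel_measurable M"
    and V_int: "\<And>k. integrable M (V k)"
    and V_nonneg: "\<And>k \<omega>. \<omega> \<in> space M \<Longrightarrow> 0 \<le> V k \<omega>"
    and c: "0 \<le> c"
    and dec: "\<And>k A. k \<ge> n \<Longrightarrow> A = {\<omega> \<in> E. \<forall>j\<in>{n..k}. V j \<omega> < c} \<Longrightarrow>
       expectation (\<lambda>\<omega>. indicator A \<omega> * V (Suc k) \<omega>) \<le> expectation (\<lambda>\<omega>. indicator A \<omega> * V k \<omega>)"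
  shows "c * prob {\<omega> \<in> E. \<exists>k\<ge>n. c \<le> V k \<omega>} \<le> expectation (\<lambda>\<omega>. indicator E \<omega> * V n \<omega>)"
proof -
  define B where "B k = {\<omega> \<in> E. \<forall>j\<in>{n..<k}. V j \<omega> < c}" for k
  have E_sub: "E \<subseteq> space M" using sets.sets_into_space[OF E] .
  have B_eq: "B k = {\<omega> \<in> space M. \<omega> \<in> E \<and> (\<forall>j\<in>{n..<k}. V j \<omega> < c)}" for k
    using E_sub by (auto simp: B_def)
  have B_meas[measurable]: "B k \<in> events" for k unfolding B_eq by measurable
  have int: "integrable M (\<lambda>\<omega>. indicator A \<omega> * V k \<omega>)" if "A \<in> events" for A k
    using integrable_mult_indicator[OF that V_int[of k]] by simp
  \<comment> \<open>The invariant: paths in \<open>E - B k\<close>, which reached \<open>c\<close>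
    before time \<open>k\<close>, are charged \<open>c\<close> from their crossing on, while those
    in \<open>B k\<close> still carry their current value of \<open>V\<close>.\<close>
  have main: "c * prob (E - B k) + expectation (\<lambda>\<omega>. indicator (B k) \<omega> * V k \<omega>)
      \<le> expectation (\<lambda>\<omega>. indicator E \<omega> * V n \<omega>)" if "k \<ge> n" for k
    using that
  proof (induction k rule: dec_induct)
    case base
    then show ?case by (simp add: B_def)
  next
    case (step k)
    let ?D = "B k - B (Suc k)"
    have BS: "B (Suc k) = {\<omega> \<in> E. \<forall>j\<in>{n..k}. V j \<omega> < c}"
      by (simp add: B_def atLeastLessThanSuc_atLeastAtMost)
    have sub: "B (Suc k) \<subseteq> B k" by (auto simp: B_def)
    have V_D: "c \<le> V k \<omega>" if "\<omega> \<in> ?D" for \<omega>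
      using that \<open>n \<le> k\<close> by (force simp: B_def less_Suc_eq)
    have "c * prob ?D = expectation (\<lambda>\<omega>. c * indicator ?D \<omega>)"
      using E_sub by (simp add: Int_absorb1 B_def subset_iff)
    also have "\<dots> \<le> expectation (\<lambda>\<omega>. indicator ?D \<omega> * V k \<omega>)"
    proof (intro integral_mono int)
      show "integrable M (\<lambda>\<omega>. c * indicator ?D \<omega> :: real)"
        by (intro integrable_mult_right integrable_real_indicator) (auto simp: less_top[symmetric])
    qed (use V_D in \<open>auto simp: indicator_def\<close>)
    also have "\<dots> = expectation (\<lambda>\<omega>. indicator (B k) \<omega> * V k \<omega> - indicator (B (Suc k)) \<omega> * V k \<omega>)"
      using sub by (intro Bochner_Integration.integral_cong) (auto simp: indicator_def)
    also have "\<dots> = expectation (\<lambda>\<omega>. indicator (B k) \<omega> * V k \<omega>)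
        - expectation (\<lambda>\<omega>. indicator (B (Suc k)) \<omega> * V k \<omega>)"
      by (intro Bochner_Integration.integral_diff int) auto
    finally have 1: "c * prob ?D \<le> \<dots>" .
    have "prob (E - B (Suc k)) = prob ((E - B k) \<union> ?D)"
      using sub by (intro arg_cong[where f = prob]) (auto simp: B_def)
    also have "\<dots> = prob (E - B k) + prob ?D"
      by (intro finite_measure_Union) auto
    finally have 2: "c * prob (E - B (Suc k)) = c * prob (E - B k) + c * prob ?D"
      by (simp add: algebra_simps)
    show ?case using 1 2 step.IH dec[OF \<open>n \<le> k\<close> BS] by linarith
  qed
  have bound: "c * prob (E - B k) \<le> expectation (\<lambda>\<omega>. indicator E \<omega> * V n \<omega>)" if "k \<ge> n" for k
  proof -
    have "0 \<le> expectation (\<lambda>\<omega>. indicator (B k) \<omega> * V k \<omega>)"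
      by (intro Bochner_Integration.integral_nonneg) (simp add: V_nonneg)
    then show ?thesis using main[OF that] by linarith
  qed
  have "incseq (\<lambda>k. E - B k)" by (auto simp: incseq_def B_def)
  then have "(\<lambda>k. prob (E - B k)) \<longlonglongrightarrow> prob (\<Union>k. E - B k)"
    by (intro finite_Lim_measure_incseq) auto
  also have "(\<Union>k. E - B k) = {\<omega> \<in> E. \<exists>k\<ge>n. c \<le> V k \<omega>}"
    by (fastforce simp: B_def not_less)
  finally have "(\<lambda>k. c * prob (E - B k)) \<longlonglongrightarrow> c * prob {\<omega> \<in> E. \<exists>k\<ge>n. c \<le> V k \<omega>}"
    by (intro tendsto_mult tendsto_const)
  then show ?thesis
    by (rule LIMSEQ_le_const2) (use bound in blast)
qed

section \<open>A test function on the scale of the noise\<close>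

text \<open>Second-order expansion of the reciprocal about \<open>u\<close> with exact remainder.
  Since the remainder contains \<open>1 / v\<close>, its use requires a lower bound on the new
  denominator.\<close>

lemma inverse_expansion:
  fixes u v :: real
  assumes "u \<noteq> 0" "v \<noteq> 0"
  shows "1 / v = 1 / u - (v - u) / u\<^sup>2 + (v - u)\<^sup>2 / (u\<^sup>2 * v)"
  using assms by (simp add: field_simps power2_eq_square)

text \<open>Passing from \<open>n\<close>, \<open>y\<close> to \<open>n + 1\<close>,
  \<open>y + d\<close> adds \<open>\<delta>\<close> to the denominator \<open>D\<close>. What
  matters is the order in \<open>\<kappa>\<close>: \<open>\<delta>\<close> is linear in it, whereas
  the error carries \<open>\<kappa>^2\<close> and can be absorbed when \<open>\<kappa>\<close> is
  small.\<close>

lemma inverse_quadratic_increment: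
  fixes n \<rho> y d \<kappa> :: real
  assumes n: "n \<ge> 1" and \<rho>: "0 \<le> \<rho>" "\<rho> \<le> 1" "(n + 1) * \<rho> \<le> 9/8"
    and y: "\<bar>y\<bar> \<le> 1/2" and d: "\<bar>d\<bar> \<le> \<rho>" and \<kappa>: "0 < \<kappa>" "\<kappa> \<le> 1/4"
  defines "D \<equiv> 1 + \<kappa> * n * y\<^sup>2" and "\<delta> \<equiv> \<kappa> * (y\<^sup>2 + (n + 1) * (2 * y * d + d\<^sup>2))"
  shows "1 / (1 + \<kappa> * (n + 1) * (y + d)\<^sup>2) \<le> 1 / D - \<delta> / D\<^sup>2 + \<kappa>\<^sup>2 * (36 * y\<^sup>2 + 16 / n\<^sup>2) / D\<^sup>2"
proof -
  have D1: "D \<ge> 1" using n \<kappa> by (simp add: D_def)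
  have nd: "(n + 1) * \<bar>d\<bar> \<le> 9/8"
    using mult_left_mono[OF d, of "n+1"] n \<rho> by linarith
  have dn: "n * \<bar>d\<bar> \<le> 9/8"
    using nd n by (simp add: algebra_simps)
  have d1: "\<bar>d\<bar> \<le> 1" using d \<rho> by simp
  have dn': "\<bar>d\<bar> \<le> 9/8 / n" using dn n by (simp add: field_simps)
  have ndd: "(n + 1) * d\<^sup>2 \<le> 9/8 * \<bar>d\<bar>"
    using mult_right_mono[OF nd, of "\<bar>d\<bar>"] by (simp add: power2_eq_square mult.assoc)
  have eq: "1 + \<kappa> * (n + 1) * (y + d)\<^sup>2 = D + \<delta>"
    by (simp add: D_def \<delta>_def power2_eq_square algebra_simps)
  \<comment> \<open>The new denominator is at least half the old one, hence at least
    \<open>1/2\<close>, so the remainder of the expansion is at most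
    \<open>2 * \<delta>^2 / D^2\<close>.\<close>
  have half: "D / 2 \<le> D + \<delta>"
  proof -
    have "y\<^sup>2 / 2 - d\<^sup>2 \<le> (y + d)\<^sup>2"
      using zero_le_power2[of "y + 2 * d"] by (simp add: power2_eq_square algebra_simps)
    then have "\<kappa> * (n + 1) * (y\<^sup>2 / 2 - d\<^sup>2) \<le> \<kappa> * (n + 1) * (y + d)\<^sup>2"
      using n \<kappa> by (intro mult_left_mono) auto
    moreover have "\<kappa> * ((n + 1) * d\<^sup>2) \<le> 1/4 * (9/8)"
      using ndd d1 \<kappa> n by (intro mult_mono) auto
    moreover have "0 \<le> \<kappa> * y\<^sup>2" using \<kappa> by simp
    ultimately show ?thesis unfolding eq[symmetric] by (simp add: D_def algebra_simps)
  qed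
  have abs\<delta>: "\<bar>\<delta>\<bar> \<le> \<kappa> * (3 * \<bar>y\<bar> + 2 / n)"
  proof -
    have "y\<^sup>2 \<le> 1/2 * \<bar>y\<bar>"
      using mult_right_mono[OF y, of "\<bar>y\<bar>"] by (simp add: power2_eq_square)
    moreover have "\<bar>(n + 1) * (2 * y * d)\<bar> \<le> 9/4 * \<bar>y\<bar>"
      using mult_right_mono[OF nd, of "2 * \<bar>y\<bar>"] n by (simp add: abs_mult mult_ac)
    moreover have "(n + 1) * d\<^sup>2 \<le> 2 / n"
    proof -
      have "9/8 * \<bar>d\<bar> \<le> 9/8 * (9/8 / n)" using dn' by (intro mult_left_mono) auto
      also have "\<dots> \<le> 2 / n" using n by (simp add: field_simps)
      finally show ?thesis using ndd by linarith
    qed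
    moreover have "0 \<le> (n + 1) * d\<^sup>2" "0 \<le> y\<^sup>2" using n by simp_all
    ultimately have "\<bar>y\<^sup>2 + ((n + 1) * (2 * y * d) + (n + 1) * d\<^sup>2)\<bar> \<le> 3 * \<bar>y\<bar> + 2 / n"
      by linarith
    then have "\<kappa> * \<bar>y\<^sup>2 + (n + 1) * (2 * y * d + d\<^sup>2)\<bar> \<le> \<kappa> * (3 * \<bar>y\<bar> + 2 / n)"
      using \<kappa> by (intro mult_left_mono) (simp_all add: distrib_left)
    then show ?thesis using \<kappa> by (simp add: \<delta>_def abs_mult)
  qed
  have \<delta>2: "\<delta>\<^sup>2 \<le> \<kappa>\<^sup>2 * (18 * y\<^sup>2 + 8 / n\<^sup>2)"
  proof -
    have "\<delta>\<^sup>2 \<le> (\<kappa> * (3 * \<bar>y\<bar> + 2 / n))\<^sup>2"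
      using abs\<delta> by (metis abs_ge_zero power2_abs power_mono)
    also have "\<dots> = \<kappa>\<^sup>2 * (3 * \<bar>y\<bar> + 2 / n)\<^sup>2" by (simp add: power_mult_distrib)
    also have "\<dots> \<le> \<kappa>\<^sup>2 * (18 * y\<^sup>2 + 8 / n\<^sup>2)"
    proof (intro mult_left_mono)
      have "(3 * \<bar>y\<bar> + 2 / n)\<^sup>2 + (3 * \<bar>y\<bar> - 2 / n)\<^sup>2 = 18 * y\<^sup>2 + 8 / n\<^sup>2"
        by (simp add: power2_sum power2_diff power_mult_distrib power_divide)
      then show "(3 * \<bar>y\<bar> + 2 / n)\<^sup>2 \<le> 18 * y\<^sup>2 + 8 / n\<^sup>2"
        using zero_le_power2[of "3 * \<bar>y\<bar> - 2 / n"] by linarith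
    qed simp
    finally show ?thesis .
  qed
  have pos: "D + \<delta> > 0" using half D1 by linarith
  have "1 / (D + \<delta>) = 1 / D - \<delta> / D\<^sup>2 + \<delta>\<^sup>2 / (D\<^sup>2 * (D + \<delta>))"
    using inverse_expansion[of D "D + \<delta>"] pos D1 by simp
  also have "\<delta>\<^sup>2 / (D\<^sup>2 * (D + \<delta>)) \<le> \<delta>\<^sup>2 / (D\<^sup>2 * (1/2))"
    using half D1 by (intro divide_left_mono mult_left_mono) auto
  also have "\<dots> \<le> \<kappa>\<^sup>2 * (36 * y\<^sup>2 + 16 / n\<^sup>2) / D\<^sup>2"
  proof -
    have "\<delta>\<^sup>2 * 2 \<le> \<kappa>\<^sup>2 * (36 * y\<^sup>2 + 16 / n\<^sup>2)"
    proof -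
      have "\<kappa>\<^sup>2 * (36 * y\<^sup>2 + 16 / n\<^sup>2) = \<kappa>\<^sup>2 * (18 * y\<^sup>2 + 8 / n\<^sup>2) * 2"
        by (simp add: algebra_simps)
      then show ?thesis using \<delta>2 by linarith
    qed
    then have "\<delta>\<^sup>2 * 2 / D\<^sup>2 \<le> \<kappa>\<^sup>2 * (36 * y\<^sup>2 + 16 / n\<^sup>2) / D\<^sup>2"
      by (intro divide_right_mono) auto
    then show ?thesis by simp
  qed
  finally show ?thesis unfolding eq by simp
qed

text \<open>Here \<open>T = sqrt n * y\<close> is the fluctuation on the scale of the noise; the mean of
  \<open>1 / (1 + \<kappa> * T^2)\<close> decays because rescaling by \<open>sqrt n\<close> alone is already repelling and, for a
  small \<open>\<kappa>\<close>, the curvature of the test function cannot compensate it.\<close>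

lemma inverse_quadratic_drift:
  fixes n \<rho> y p w s \<kappa> :: real
  assumes n: "n \<ge> 1" "8 / (18 * s) \<le> n" and \<rho>: "1/2 \<le> n * \<rho>" "\<rho> \<le> 1" "(n + 1) * \<rho> \<le> 9/8"
    and y: "\<bar>y\<bar> \<le> 1/2" and p: "0 \<le> p" "p \<le> 1" and s: "0 < s" "s \<le> p * (1 - p)"
    and w: "p - 1/2 - y = y * w" "- 1/3 \<le> w"
  defines "\<kappa> \<equiv> 1/288"
  shows "p * (1 / (1 + \<kappa> * (n + 1) * (y + \<rho> * (1/2 - y))\<^sup>2))
       + (1 - p) * (1 / (1 + \<kappa> * (n + 1) * (y + \<rho> * (- 1/2 - y))\<^sup>2))
     \<le> (1 - \<kappa> * s / 8 / n) * (1 / (1 + \<kappa> * n * y\<^sup>2))"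
proof -
  define D where "D = 1 + \<kappa> * n * y\<^sup>2"
  define e where "e = \<kappa>\<^sup>2 * (36 * y\<^sup>2 + 16 / n\<^sup>2)"
  define \<delta> where "\<delta> d = \<kappa> * (y\<^sup>2 + (n + 1) * (2 * y * d + d\<^sup>2))" for d
  define A1 where "A1 = 1/2 - y"
  define A0 where "A0 = - 1/2 - y"
  have \<kappa>: "0 < \<kappa>" "\<kappa> \<le> 1/4" by (simp_all add: \<kappa>_def)
  have \<rho>0: "0 \<le> \<rho>" using \<rho>(1) n(1) zero_less_mult_pos[of n \<rho>] by linarith
  have D1: "D \<ge> 1" using n \<kappa> by (simp add: D_def)
  have A: "\<bar>\<rho> * A1\<bar> \<le> \<rho>" "\<bar>\<rho> * A0\<bar> \<le> \<rho>"
    using y \<rho>0 mult_left_mono[of "\<bar>A1\<bar>" 1 \<rho>] mult_left_mono[of "\<bar>A0\<bar>" 1 \<rho>]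
    by (simp_all add: abs_mult A1_def A0_def abs_le_iff)
  have bnd: "1 / (1 + \<kappa> * (n + 1) * (y + d)\<^sup>2) \<le> 1 / D - \<delta> d / D\<^sup>2 + e / D\<^sup>2" if "\<bar>d\<bar> \<le> \<rho>" for d
    using inverse_quadratic_increment[OF n(1) \<rho>0 \<rho>(2,3) y that \<kappa>] by (simp add: D_def \<delta>_def e_def)
  \<comment> \<open>The displacement has mean \<open>\<rho> * y * w\<close> and second moment
    \<open>\<rho>^2 * (p * (1 - p) + (y * w)^2)\<close>. The leading \<open>1\<close> next to
    \<open>w\<close> comes from replacing \<open>n\<close> by \<open>n + 1\<close>.\<close>
  have mean: "p * \<delta> (\<rho> * A1) + (1 - p) * \<delta> (\<rho> * A0)
      = \<kappa> * (y\<^sup>2 * (1 + 2 * ((n + 1) * \<rho>) * w) + (n + 1) * \<rho>\<^sup>2 * (p * (1 - p) + (y * w)\<^sup>2))"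
  proof -
    have 1: "p * A1 + (1 - p) * A0 = y * w"
      unfolding w(1)[symmetric] by (simp add: A1_def A0_def field_simps)
    have 2: "p * A1\<^sup>2 + (1 - p) * A0\<^sup>2 = p * (1 - p) + (y * w)\<^sup>2"
      unfolding w(1)[symmetric] by (simp add: A1_def A0_def field_simps power2_eq_square)
    have "p * \<delta> (\<rho> * A1) + (1 - p) * \<delta> (\<rho> * A0)
      = \<kappa> * (y\<^sup>2 + (n + 1) * (2 * y * \<rho> * (p * A1 + (1 - p) * A0)
          + \<rho>\<^sup>2 * (p * A1\<^sup>2 + (1 - p) * A0\<^sup>2)))"
      by (simp add: \<delta>_def algebra_simps power2_eq_square)
    then show ?thesis unfolding 1 2 by (simp add: algebra_simps power2_eq_square)
  qed
  \<comment> \<open>\<open>1 - 2 * 9/8 * 1/3 = 1/4\<close>: the rescaling outweighs even the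
    strongest inward drift allowed.\<close>
  have "1/4 \<le> 1 + 2 * ((n + 1) * \<rho>) * w"
    using mult_left_mono[OF w(2), of "2 * ((n+1)*\<rho>)"] \<rho>(3) n \<rho>0 by simp
  then have m1: "y\<^sup>2 * (1/4) \<le> y\<^sup>2 * (1 + 2 * ((n + 1) * \<rho>) * w)"
    by (intro mult_left_mono) auto
  have "1/(4*n) \<le> (n + 1) * \<rho>\<^sup>2"
  proof -
    have "(1/2)\<^sup>2 \<le> (n * \<rho>)\<^sup>2" using \<rho> by (intro power_mono) auto
    then have "1/(4*n) \<le> n * \<rho>\<^sup>2" using n by (simp add: field_simps power2_eq_square)
    also have "\<dots> \<le> (n + 1) * \<rho>\<^sup>2" by (intro mult_right_mono) auto
    finally show ?thesis .
  qed
  then have m2: "1/(4*n) * s \<le> (n + 1) * \<rho>\<^sup>2 * (p * (1 - p) + (y * w)\<^sup>2)"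
    using s n by (intro mult_mono) (auto intro: add_increasing2)
  have "\<kappa> * (y\<^sup>2 * (1/4) + 1/(4*n) * s) \<le> p * \<delta> (\<rho> * A1) + (1 - p) * \<delta> (\<rho> * A0)"
    unfolding mean using \<kappa> by (intro mult_left_mono[OF add_mono[OF m1 m2]]) simp
  \<comment> \<open>Half of the first-order gain pays for the error. For the \<open>y^2\<close> term
    \<open>36/288 = 1/8\<close> is half of \<open>1/4\<close>; for the variance term
    \<open>16/288 = 1/18\<close>, and \<open>n \<ge> 8 / (18 * s)\<close> is exactly what is
    needed.\<close>
  moreover have "e \<le> \<kappa> * (y\<^sup>2 * (1/8) + 1/(8*n) * s)"
  proof -
    have "\<kappa> * (16 / n\<^sup>2) \<le> 1/(8*n) * s"
    proof -
      have "8 \<le> n * (18 * s)" using n s by (simp add: field_simps)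
      then show ?thesis using n by (simp add: \<kappa>_def field_simps power2_eq_square)
    qed
    then have "\<kappa> * (\<kappa> * (36 * y\<^sup>2 + 16 / n\<^sup>2)) \<le> \<kappa> * (y\<^sup>2 * (1/8) + 1/(8*n) * s)"
      using \<kappa> by (intro mult_left_mono) (auto simp: \<kappa>_def)
    then show ?thesis by (simp add: e_def power2_eq_square mult.assoc)
  qed
  \<comment> \<open>The other half yields the contraction. Expanding \<open>D\<close> gives the
    remaining variance term plus a multiple of \<open>y^2\<close>, which is covered because
    \<open>\<kappa> * s \<le> 1\<close>.\<close>
  moreover have "\<kappa> * s / 8 / n * D \<le> \<kappa> * (y\<^sup>2 * (1/8) + 1/(8*n) * s)"
  proof -
    have "s \<le> 1" using s p mult_le_one[of p "1-p"] by linarith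
    then have "\<kappa> * s \<le> 1" using mult_le_one[of \<kappa> s] \<kappa> s by linarith
    then have "\<kappa> * s * (\<kappa> * y\<^sup>2 / 8) \<le> \<kappa> * y\<^sup>2 / 8"
      using \<kappa> by (intro mult_left_le_one_le) (auto intro: mult_nonneg_nonneg s less_imp_le)
    moreover have "\<kappa> * s / 8 / n * D = \<kappa> * (1/(8*n) * s) + \<kappa> * s * (\<kappa> * y\<^sup>2 / 8)"
      using n by (simp add: D_def field_simps)
    ultimately show ?thesis by (simp add: distrib_left)
  qed
  ultimately have key: "\<kappa> * s / 8 / n * D \<le> p * \<delta> (\<rho> * A1) + (1 - p) * \<delta> (\<rho> * A0) - e"
    by (simp add: algebra_simps)
  have "p * (1 / (1 + \<kappa> * (n + 1) * (y + \<rho> * A1)\<^sup>2)) + (1 - p) * (1 / (1 + \<kappa> * (n + 1) * (y + \<rho> * A0)\<^sup>2))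
      \<le> p * (1 / D - \<delta> (\<rho> * A1) / D\<^sup>2 + e / D\<^sup>2) + (1 - p) * (1 / D - \<delta> (\<rho> * A0) / D\<^sup>2 + e / D\<^sup>2)"
    using bnd A p by (intro add_mono mult_left_mono) auto
  also have "\<dots> = 1 / D - (p * \<delta> (\<rho> * A1) + (1 - p) * \<delta> (\<rho> * A0) - e) / D\<^sup>2"
    by (simp add: algebra_simps add_divide_distrib diff_divide_distrib)
  also have "\<dots> \<le> 1 / D - (\<kappa> * s / 8 / n * D) / D\<^sup>2"
    using key by (intro diff_left_mono divide_right_mono) auto
  also have "\<dots> = (1 - \<kappa> * s / 8 / n) * (1 / D)"
    using D1 by (simp add: field_simps power2_eq_square)
  finally show ?thesis by (simp add: D_def A1_def A0_def)
qed

section \<open>Almost sure convergence\<close>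

locale majority_process = single_unit_process M r "f_theta \<theta>" Z I
  for M :: "'a measure" and r \<theta> Z I +
  assumes theta: "1/2 < \<theta>" "\<theta> < 1"
begin

abbreviation (input) \<F> :: "nat \<Rightarrow> 'a measure" where "\<F> \<equiv> past M Z I"

lemma r_bounds: "0 \<le> r n" "r n \<le> 1"
  using r_range[of n] by auto

lemma Z_range: "\<omega> \<in> space M \<Longrightarrow> 0 \<le> Z n \<omega> \<and> Z n \<omega> \<le> 1"
proof (induction n)
  case 0
  then show ?case using Z0_range by auto
next
  case (Suc n)
  have "I (Suc n) \<omega> \<in> {0, 1}" using I_range Suc.prems by blast
  moreover have "(1 - r n) * Z n \<omega> \<le> (1 - r n) * 1" "0 \<le> (1 - r n) * Z n \<omega>"
    using Suc r_bounds[of n] by (intro mult_left_mono mult_nonneg_nonneg; simp)+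
  ultimately show ?case using Z_step[OF Suc.prems] r_bounds[of n] by auto
qed

lemma f_range:
  assumes "\<omega> \<in> space M"
  shows "1 - \<theta> \<le> f_theta \<theta> (Z n \<omega>)" "f_theta \<theta> (Z n \<omega>) \<le> \<theta>"
    "0 \<le> f_theta \<theta> (Z n \<omega>)" "f_theta \<theta> (Z n \<omega>) \<le> 1"
  using f_theta_bounds[OF theta(1), of "Z n \<omega>"] Z_range[OF assms, of n] theta by auto

lemma measurable_f_theta [measurable]: "f_theta \<theta> \<in> borel_measurable borel"
  unfolding f_theta_def by measurable

lemma measurable_Z [measurable]: "Z n \<in> borel_measurable M"
proof (induction n)
  case 0
  then show ?case using Z0_measurable by simp
next
  case (Suc n)
  note [measurable] = Suc I_measurable[of n]
  have "(\<lambda>\<omega>. (1 - r n) * Z n \<omega> + r n * I (Suc n) \<omega>) \<in> borel_measurable M" by measurable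
  moreover have "Z (Suc n) \<in> borel_measurable M
      \<longleftrightarrow> (\<lambda>\<omega>. (1 - r n) * Z n \<omega> + r n * I (Suc n) \<omega>) \<in> borel_measurable M"
    by (rule measurable_cong) (simp add: Z_step)
  ultimately show ?case by blast
qed

section \<open>Adaptedness and one-step expectations\<close>

lemma space_past [simp]: "space (\<F> n) = space M"
  unfolding past_def by (rule space_measure_of_conv)

lemma sets_past:
  "sets (\<F> n) = sigma_sets (space M)
     ({Z 0 -` A \<inter> space M | A. A \<in> sets borel} \<union>
      {I i -` A \<inter> space M | i A. i \<in> {1..n} \<and> A \<in> sets borel})"
  unfolding past_def by (rule sets_measure_of) auto

lemma subalgebra_past: "subalgebra M (\<F> n)"
proof -
  have "I i -` A \<inter> space M \<in> events" if "i \<in> {1..n}" "A \<in> sets borel" for i A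
  proof -
    obtain j where "i = Suc j" using \<open>i \<in> {1..n}\<close> by (cases i) auto
    then show ?thesis using measurable_sets[OF I_measurable \<open>A \<in> sets borel\<close>] by simp
  qed
  moreover have "Z 0 -` A \<inter> space M \<in> events" if "A \<in> sets borel" for A
    using measurable_sets[OF Z0_measurable that] .
  ultimately show ?thesis
    unfolding subalgebra_def sets_past
    by (auto intro!: sets.sigma_sets_subset simp: past_def space_measure_of_conv)
qed

lemma measurable_I_past: "1 \<le> i \<Longrightarrow> i \<le> n \<Longrightarrow> I i \<in> borel_measurable (\<F> n)"
  by (rule measurableI) (auto simp: sets_past intro!: sigma_sets.Basic)

lemma measurable_Z_past: "m \<le> n \<Longrightarrow> Z m \<in> borel_measurable (\<F> n)"
proof (induction m)
  case 0
  show ?case by (rule measurableI) (auto simp: sets_past intro!: sigma_sets.Basic)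
next
  case (Suc m)
  have [measurable]: "Z m \<in> borel_measurable (\<F> n)" "I (Suc m) \<in> borel_measurable (\<F> n)"
    using Suc measurable_I_past by auto
  have "(\<lambda>\<omega>. (1 - r m) * Z m \<omega> + r m * I (Suc m) \<omega>) \<in> borel_measurable (\<F> n)" by measurable
  moreover have "Z (Suc m) \<in> borel_measurable (\<F> n)
      \<longleftrightarrow> (\<lambda>\<omega>. (1 - r m) * Z m \<omega> + r m * I (Suc m) \<omega>) \<in> borel_measurable (\<F> n)"
    by (rule measurable_cong) (simp add: Z_step)
  ultimately show ?case by blast
qed

lemma sets_past_mono: "m \<le> n \<Longrightarrow> sets (\<F> m) \<subseteq> sets (\<F> n)"
proof -
  assume "m \<le> n"
  then have "{1..m} \<subseteq> {1..n}" by auto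
  then show ?thesis unfolding sets_past by (intro sigma_sets_mono' Un_mono subset_refl) blast
qed

lemma past_events: "A \<in> sets (\<F> n) \<Longrightarrow> A \<in> events"
  using subalgebra_past unfolding subalgebra_def by blast

lemma bounded_integrable:
  fixes G :: "'a \<Rightarrow> real"
  assumes "G \<in> borel_measurable M" "\<And>\<omega>. \<omega> \<in> space M \<Longrightarrow> \<bar>G \<omega>\<bar> \<le> B"
  shows "integrable M G"
  using assms by (intro integrable_const_bound[where B = B]) auto

text \<open>The conditional law of \<open>I\<close> enters the argument only here. The selected
  value is \<open>G0\<close> plus a past-measurable difference times the indicator of the outcome
  \<open>1\<close>, and under the integral that indicator may be replaced by its conditional
  expectation.\<close>

lemma expectation_step:
  fixes G1 G0 :: "'a \<Rightarrow> real"
  assumes G: "G1 \<in> borel_measurable (\<F> n)" "G0 \<in> borel_measurable (\<F> n)"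
    and B: "\<And>\<omega>. \<omega> \<in> space M \<Longrightarrow> \<bar>G1 \<omega>\<bar> \<le> B" "\<And>\<omega>. \<omega> \<in> space M \<Longrightarrow> \<bar>G0 \<omega>\<bar> \<le> B"
  shows "expectation (\<lambda>\<omega>. if I (Suc n) \<omega> = 1 then G1 \<omega> else G0 \<omega>)
       = expectation (\<lambda>\<omega>. f_theta \<theta> (Z n \<omega>) * G1 \<omega> + (1 - f_theta \<theta> (Z n \<omega>)) * G0 \<omega>)"
proof -
  interpret sub: finite_measure_subalgebra M "\<F> n"
    by unfold_locales (rule subalgebra_past)
  have [measurable]: "G1 \<in> borel_measurable M" "G0 \<in> borel_measurable M"
    using measurable_from_subalg[OF subalgebra_past] G by auto
  note [measurable] = I_measurable[of n]
  let ?J = "{\<omega> \<in> space M. I (Suc n) \<omega> = 1}"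
  let ?D = "\<lambda>\<omega>. G1 \<omega> - G0 \<omega>"
  let ?f = "\<lambda>\<omega>. f_theta \<theta> (Z n \<omega>)"
  have D_bound: "\<bar>?D \<omega>\<bar> \<le> 2 * B" if "\<omega> \<in> space M" for \<omega>
    using B[OF that] by linarith
  have int_J: "integrable M (\<lambda>\<omega>. ?D \<omega> * indicator ?J \<omega>)"
  proof (rule bounded_integrable[where B = "2 * B"])
    fix \<omega> assume "\<omega> \<in> space M"
    then show "\<bar>?D \<omega> * indicator ?J \<omega>\<bar> \<le> 2 * B"
      using D_bound[of \<omega>] by (simp add: indicator_def)
  qed simp
  have int_f: "integrable M (\<lambda>\<omega>. ?D \<omega> * ?f \<omega>)"
  proof (rule bounded_integrable[where B = "2 * B"])
    fix \<omega> assume "\<omega> \<in> space M"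
    then show "\<bar>?D \<omega> * ?f \<omega>\<bar> \<le> 2 * B"
      using mult_mono[OF D_bound, of \<omega> "\<bar>?f \<omega>\<bar>" 1] f_range[of \<omega> n] D_bound[of \<omega>]
      by (simp add: abs_mult)
  qed simp
  have int_0: "integrable M G0"
    by (rule bounded_integrable[where B = B]) (use B in auto)
  have "expectation (\<lambda>\<omega>. if I (Suc n) \<omega> = 1 then G1 \<omega> else G0 \<omega>)
      = expectation (\<lambda>\<omega>. ?D \<omega> * indicator ?J \<omega> + G0 \<omega>)"
    by (intro Bochner_Integration.integral_cong) (auto simp: indicator_def)
  also have "\<dots> = expectation (\<lambda>\<omega>. ?D \<omega> * indicator ?J \<omega>) + expectation G0"
    using int_J int_0 by (rule Bochner_Integration.integral_add)
  also have "expectation (\<lambda>\<omega>. ?D \<omega> * indicator ?J \<omega>)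
      = expectation (\<lambda>\<omega>. ?D \<omega> * real_cond_exp M (\<F> n) (indicator ?J) \<omega>)"
    using int_J G by (intro sub.real_cond_exp_intg(2)[symmetric]) auto
  also have "\<dots> = expectation (\<lambda>\<omega>. ?D \<omega> * ?f \<omega>)"
    using I_cond[of n] by (intro integral_cong_AE) auto
  also have "\<dots> + expectation G0 = expectation (\<lambda>\<omega>. ?D \<omega> * ?f \<omega> + G0 \<omega>)"
    using int_f int_0 by (rule Bochner_Integration.integral_add[symmetric])
  finally show ?thesis by (simp add: algebra_simps)
qed

lemma expectation_step_le:
  fixes G1 G0 U :: "'a \<Rightarrow> real"
  assumes G: "G1 \<in> borel_measurable (\<F> n)" "G0 \<in> borel_measurable (\<F> n)"
    and B: "\<And>\<omega>. \<omega> \<in> space M \<Longrightarrow> \<bar>G1 \<omega>\<bar> \<le> B" "\<And>\<omega>. \<omega> \<in> space M \<Longrightarrow> \<bar>G0 \<omega>\<bar> \<le> B"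
    and H: "\<And>\<omega>. \<omega> \<in> space M \<Longrightarrow> H \<omega> = (if I (Suc n) \<omega> = 1 then G1 \<omega> else G0 \<omega>)"
    and U: "integrable M U" "\<And>\<omega>. \<omega> \<in> space M \<Longrightarrow>
      f_theta \<theta> (Z n \<omega>) * G1 \<omega> + (1 - f_theta \<theta> (Z n \<omega>)) * G0 \<omega> \<le> U \<omega>"
  shows "expectation H \<le> expectation U"
proof -
  have [measurable]: "G1 \<in> borel_measurable M" "G0 \<in> borel_measurable M"
    using measurable_from_subalg[OF subalgebra_past] G by auto
  have "expectation H = expectation (\<lambda>\<omega>. if I (Suc n) \<omega> = 1 then G1 \<omega> else G0 \<omega>)"
    using H by (intro Bochner_Integration.integral_cong) auto
  also have "\<dots> = expectation (\<lambda>\<omega>. f_theta \<theta> (Z n \<omega>) * G1 \<omega> + (1 - f_theta \<theta> (Z n \<omega>)) * G0 \<omega>)"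
    by (rule expectation_step[OF G B])
  also have "\<dots> \<le> expectation U"
  proof (rule integral_mono[OF _ U])
    show "integrable M (\<lambda>\<omega>. f_theta \<theta> (Z n \<omega>) * G1 \<omega> + (1 - f_theta \<theta> (Z n \<omega>)) * G0 \<omega>)"
    proof (rule bounded_integrable[where B = B])
      fix \<omega> assume \<omega>: "\<omega> \<in> space M"
      have "\<bar>f_theta \<theta> (Z n \<omega>) * G1 \<omega> + (1 - f_theta \<theta> (Z n \<omega>)) * G0 \<omega>\<bar>
          \<le> f_theta \<theta> (Z n \<omega>) * \<bar>G1 \<omega>\<bar> + (1 - f_theta \<theta> (Z n \<omega>)) * \<bar>G0 \<omega>\<bar>"
        using f_range[OF \<omega>, of n] abs_triangle_ineq[of "f_theta \<theta> (Z n \<omega>) * G1 \<omega>" "(1 - f_theta \<theta> (Z n \<omega>)) * G0 \<omega>"]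
        by (simp add: abs_mult)
      also have "\<dots> \<le> f_theta \<theta> (Z n \<omega>) * B + (1 - f_theta \<theta> (Z n \<omega>)) * B"
        using f_range[OF \<omega>, of n] B[OF \<omega>] by (intro add_mono mult_left_mono) auto
      finally show "\<bar>f_theta \<theta> (Z n \<omega>) * G1 \<omega> + (1 - f_theta \<theta> (Z n \<omega>)) * G0 \<omega>\<bar> \<le> B"
        by (simp add: algebra_simps)
    qed simp
  qed
  finally show ?thesis .
qed

text \<open>A supermartingale inequality free of conditional expectations: \<open>V1 k\<close> and
  \<open>V0 k\<close> are the values that \<open>V\<close> takes next for the two outcomes, so the
  drift condition is a pointwise inequality, wanted only below the level \<open>c\<close>. For
  \<open>j < n\<close> measurability of \<open>V j\<close> at time \<open>n\<close> is enough, so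
  \<open>V\<close> may refer to the state at time \<open>n\<close>.\<close>

lemma adapted_maximal_inequality:
  fixes V V1 V0 :: "nat \<Rightarrow> 'a \<Rightarrow> real"
  assumes E: "E \<in> sets (\<F> n)"
    and V: "\<And>j k. j \<le> k \<Longrightarrow> n \<le> k \<Longrightarrow> V j \<in> borel_measurable (\<F> k)"
    and V1: "\<And>k. n \<le> k \<Longrightarrow> V1 k \<in> borel_measurable (\<F> k)"
    and V0: "\<And>k. n \<le> k \<Longrightarrow> V0 k \<in> borel_measurable (\<F> k)"
    and B: "\<And>k \<omega>. \<omega> \<in> space M \<Longrightarrow> V k \<omega> \<in> {0..B k}"
      "\<And>k \<omega>. \<omega> \<in> space M \<Longrightarrow> V1 k \<omega> \<in> {0..B k}"
      "\<And>k \<omega>. \<omega> \<in> space M \<Longrightarrow> V0 k \<omega> \<in> {0..B k}"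
    and Suc: "\<And>k \<omega>. n \<le> k \<Longrightarrow> \<omega> \<in> space M \<Longrightarrow>
      V (Suc k) \<omega> = (if I (Suc k) \<omega> = 1 then V1 k \<omega> else V0 k \<omega>)"
    and c: "0 \<le> c"
    and drift: "\<And>k \<omega>. n \<le> k \<Longrightarrow> \<omega> \<in> space M \<Longrightarrow> V k \<omega> < c \<Longrightarrow>
      f_theta \<theta> (Z k \<omega>) * V1 k \<omega> + (1 - f_theta \<theta> (Z k \<omega>)) * V0 k \<omega> \<le> V k \<omega>"
  shows "c * prob {\<omega> \<in> E. \<exists>k\<ge>n. c \<le> V k \<omega>} \<le> expectation (\<lambda>\<omega>. indicator E \<omega> * V n \<omega>)"
proof (rule maximal_inequality)
  show "E \<in> events" using past_events E by blast
  have Vm: "V k \<in> borel_measurable M" for k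
    using measurable_from_subalg[OF subalgebra_past V[of k "max n k"]] by simp
  then show "V k \<in> borel_measurable M" for k .
  show V_int: "integrable M (V k)" for k
    using B(1)[of _ k] Vm by (intro bounded_integrable[of "V k" "B k"]) auto
  show "0 \<le> V k \<omega>" if "\<omega> \<in> space M" for k \<omega> using B(1)[OF that, of k] by simp
  show "0 \<le> c" by fact
  fix k A assume k: "n \<le> k" and A: "A = {\<omega> \<in> E. \<forall>j\<in>{n..k}. V j \<omega> < c}"
  have E_past: "E \<in> sets (\<F> k)" using E sets_past_mono[OF k] by blast
  have E_sub: "E \<subseteq> space M" using sets.sets_into_space[OF E] by simp
  have "A = {\<omega> \<in> space (\<F> k). \<omega> \<in> E \<and> (\<forall>j\<in>{n..k}. V j \<omega> < c)}"
    using E_sub by (auto simp: A)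
  also have "\<dots> \<in> sets (\<F> k)"
  proof -
    have "{\<omega> \<in> space (\<F> k). \<forall>j\<in>{n..k}. V j \<omega> < c} \<in> sets (\<F> k)"
      using V k by (intro sets.sets_Collect_finite_All borel_measurable_less) auto
    moreover have "{\<omega> \<in> space (\<F> k). \<omega> \<in> E} \<in> sets (\<F> k)"
      using E_past E_sub by (simp add: Collect_conj_eq Int_absorb1)
    ultimately show ?thesis by (rule sets.sets_Collect_conj)
  qed
  finally have A_past: "A \<in> sets (\<F> k)" .
  have A_ind: "(\<lambda>\<omega>. indicator A \<omega> :: real) \<in> borel_measurable (\<F> k)"
    using A_past by (rule borel_measurable_indicator)
  show "expectation (\<lambda>\<omega>. indicator A \<omega> * V (Suc k) \<omega>) \<le> expectation (\<lambda>\<omega>. indicator A \<omega> * V k \<omega>)"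
  proof (rule expectation_step_le[where ?G1.0 = "\<lambda>\<omega>. indicator A \<omega> * V1 k \<omega>"
        and ?G0.0 = "\<lambda>\<omega>. indicator A \<omega> * V0 k \<omega>" and n = k and B = "B k"])
    show "integrable M (\<lambda>\<omega>. indicator A \<omega> * V k \<omega>)"
      using integrable_mult_indicator[OF past_events[OF A_past] V_int[of k]] by simp
    fix \<omega> assume \<omega>: "\<omega> \<in> space M"
    show "f_theta \<theta> (Z k \<omega>) * (indicator A \<omega> * V1 k \<omega>)
        + (1 - f_theta \<theta> (Z k \<omega>)) * (indicator A \<omega> * V0 k \<omega>) \<le> indicator A \<omega> * V k \<omega>"
      using drift[OF k \<omega>] k by (auto simp: indicator_def A)
    show "\<bar>indicator A \<omega> * V1 k \<omega>\<bar> \<le> B k" "\<bar>indicator A \<omega> * V0 k \<omega>\<bar> \<le> B k"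
      using B(2,3)[OF \<omega>, of k] by (auto simp: indicator_def)
    show "indicator A \<omega> * V (Suc k) \<omega>
        = (if I (Suc k) \<omega> = 1 then indicator A \<omega> * V1 k \<omega> else indicator A \<omega> * V0 k \<omega>)"
      using Suc[OF k \<omega>] by simp
  qed (intro borel_measurable_times A_ind V1 V0 k)+
qed

end

section \<open>Fixed points of the majority function, and two auxiliary inequalities\<close>

lemma f_theta_drift:
  assumes "1/2 < \<theta>"
  shows "f_theta \<theta> (1/2 + y) - 1/2 - y
     = y * (2 * (2*\<theta> - 1) * ((3/4 - 1 / (2 * (2*\<theta> - 1))) - y\<^sup>2))"
proof -
  have "2 * (2*\<theta> - 1) * ((3/4 - 1 / (2 * (2*\<theta> - 1))) - y\<^sup>2) = (3 * (2*\<theta> - 1) / 2 - 1) - 2 * (2*\<theta> - 1) * y\<^sup>2"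
    using assms by (simp add: field_simps)
  then show ?thesis using f_theta_centered by simp
qed

lemma f_theta_eq_iff:
  assumes "1/2 < \<theta>"
  shows "f_theta \<theta> z = z \<longleftrightarrow> z = 1/2 \<or> (z - 1/2)\<^sup>2 = 3/4 - 1 / (2 * (2*\<theta> - 1))"
proof -
  let ?u = "3/4 - 1 / (2 * (2*\<theta> - 1))"
  have eq: "f_theta \<theta> z - z = (z - 1/2) * (2 * (2*\<theta> - 1) * (?u - (z - 1/2)\<^sup>2))"
    using f_theta_drift[OF assms, of "z - 1/2"] by simp
  have "f_theta \<theta> z = z \<longleftrightarrow> f_theta \<theta> z - z = 0" by simp
  also have "\<dots> \<longleftrightarrow> z - 1/2 = 0 \<or> ?u - (z - 1/2)\<^sup>2 = 0"
    unfolding eq mult_eq_0_iff using assms by auto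
  finally show ?thesis by auto
qed

lemma finite_f_theta_fixpoints:
  assumes "1/2 < \<theta>"
  shows "finite {z. f_theta \<theta> z - z = 0}"
proof (rule finite_subset)
  let ?u = "3/4 - 1 / (2 * (2*\<theta> - 1))"
  \<comment> \<open>An inclusion is enough, so a negative radicand, for which the two outer points
    are not fixed points, needs no separate case.\<close>
  show "{z. f_theta \<theta> z - z = 0} \<subseteq> {1/2, 1/2 + sqrt ?u, 1/2 - sqrt ?u}"
  proof
    fix z assume "z \<in> {z. f_theta \<theta> z - z = 0}"
    then consider "z = 1/2" | "(z - 1/2)\<^sup>2 = ?u" using f_theta_eq_iff[OF assms, of z] by auto
    then show "z \<in> {1/2, 1/2 + sqrt ?u, 1/2 - sqrt ?u}"
    proof cases
      case 2
      then have "sqrt ?u = \<bar>z - 1/2\<bar>" using real_sqrt_abs[of "z - 1/2"] by simp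
      then show ?thesis by (simp add: abs_if split: if_splits)
    qed simp
  qed
qed simp

text \<open>For large \<open>n\<close>, \<open>8 / n\<close> dominates the sum of
  \<open>(r k)^2\<close> over \<open>k \<ge> n\<close>. Adding it to a process whose conditional
  mean rises by at most \<open>(r n)^2\<close> per step produces a supermartingale. The
  \<open>8\<close> stems from \<open>n * r n < 2\<close> and
  \<open>n + 1 \<le> 2 * n\<close>.\<close>

lemma eventually_square_le_telescoping:
  fixes r :: "nat \<Rightarrow> real"
  assumes "(\<lambda>n. real n * r n) \<longlonglongrightarrow> 1" "\<And>n. 0 \<le> r n"
  shows "\<forall>\<^sub>F n in sequentially. (r n)\<^sup>2 \<le> 8 / real n - 8 / real (Suc n)"
proof -
  have "\<forall>\<^sub>F n in sequentially. real n * r n < 2"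
    using assms(1) by (rule order_tendstoD) simp
  then show ?thesis using eventually_gt_at_top[of 0]
  proof eventually_elim
    case (elim n)
    have "(real n * r n)\<^sup>2 \<le> 2\<^sup>2" using elim assms(2)[of n] by (intro power_mono) auto
    then have "(r n)\<^sup>2 \<le> 4 / (real n)\<^sup>2" using elim by (simp add: field_simps power_mult_distrib)
    also have "\<dots> = 8 / (2 * (real n)\<^sup>2)" by simp
    also have "\<dots> \<le> 8 / (real n * real (Suc n))"
      using elim by (intro divide_left_mono mult_pos_pos) (auto simp: power2_eq_square algebra_simps)
    also have "\<dots> = 8 / real n - 8 / real (Suc n)"
      using elim by (simp add: field_simps)
    finally show ?case .
  qed
qed

text \<open>Despite the kink of the positive part, its square is bounded above by the quadratic
  expansion, since \<open>max 0 (a - d) \<le> \<bar>max 0 a - d\<bar>\<close>.\<close>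

lemma square_pos_part_diff_le:
  fixes b y d :: real
  shows "(max 0 (b - (y + d)))\<^sup>2 \<le> (max 0 (b - y))\<^sup>2 - 2 * max 0 (b - y) * d + d\<^sup>2"
proof -
  have "(max 0 (b - (y + d)))\<^sup>2 \<le> \<bar>max 0 (b - y) - d\<bar>\<^sup>2"
    by (intro power_mono) auto
  then show ?thesis by (simp add: power2_diff)
qed

section \<open>The noise martingale and convergence to a fixed point\<close>

context majority_process
begin

text \<open>The summands are conditionally centred, so this is the martingale part of
  \<open>Z\<close>; the difference \<open>Z n - noise n\<close> moves by \<open>r n\<close> times
  the drift at \<open>Z n\<close>.\<close>

definition noise :: "nat \<Rightarrow> 'a \<Rightarrow> real" where
  "noise n \<omega> = (\<Sum>k<n. r k * (I (Suc k) \<omega> - f_theta \<theta> (Z k \<omega>)))"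

lemma measurable_noise_past: "m \<le> n \<Longrightarrow> noise m \<in> borel_measurable (\<F> n)"
  unfolding noise_def
proof (intro borel_measurable_sum borel_measurable_times borel_measurable_diff borel_measurable_const)
  fix k assume "m \<le> n" "k \<in> {..<m}"
  then show "I (Suc k) \<in> borel_measurable (\<F> n)"
    "(\<lambda>\<omega>. f_theta \<theta> (Z k \<omega>)) \<in> borel_measurable (\<F> n)"
    using measurable_I_past[of "Suc k" n] measurable_compose[OF measurable_Z_past measurable_f_theta, of k n]
    by auto
qed

lemma measurable_noise [measurable]: "noise n \<in> borel_measurable M"
  using measurable_from_subalg[OF subalgebra_past measurable_noise_past] by blast

lemma abs_noise_le:
  assumes "\<omega> \<in> space M"
  shows "\<bar>noise n \<omega>\<bar> \<le> real n"
proof -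
  have "\<bar>r k * (I (Suc k) \<omega> - f_theta \<theta> (Z k \<omega>))\<bar> \<le> 1" for k
  proof -
    have "\<bar>I (Suc k) \<omega> - f_theta \<theta> (Z k \<omega>)\<bar> \<le> 1"
      using I_range[OF assms, of k] f_range[OF assms, of k] by auto
    then show ?thesis using r_bounds[of k] by (simp add: abs_mult mult_le_one)
  qed
  then have "\<bar>noise n \<omega>\<bar> \<le> (\<Sum>k<n. 1)"
    unfolding noise_def by (intro sum_abs[THEN order_trans] sum_mono) auto
  then show ?thesis by simp
qed

lemma ex_telescoping_start:
  obtains N where "0 < N" "\<And>n. N \<le> n \<Longrightarrow> (r n)\<^sup>2 \<le> 8 / real n - 8 / real (Suc n)"
proof -
  obtain N where "\<And>n. N \<le> n \<Longrightarrow> (r n)\<^sup>2 \<le> 8 / real n - 8 / real (Suc n)"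
    using eventually_square_le_telescoping[OF r_lim r_bounds(1)]
    unfolding eventually_sequentially by blast
  then show ?thesis using that[of "Suc N"] by simp
qed

text \<open>The squared noise accumulated since time \<open>n\<close> grows in conditional mean by
  at most \<open>(r k)^2\<close>, so adding \<open>8 / k\<close> makes it a supermartingale; at time
  \<open>n\<close> only \<open>8 / n\<close> is left of it.\<close>

lemma noise_tail_bound:
  assumes r: "\<And>k. n \<le> k \<Longrightarrow> (r k)\<^sup>2 \<le> 8 / real k - 8 / real (Suc k)" and "0 < \<epsilon>"
  shows "\<epsilon>\<^sup>2 * prob {\<omega> \<in> space M. \<exists>k\<ge>n. \<epsilon> \<le> \<bar>noise k \<omega> - noise n \<omega>\<bar>} \<le> 8 / real n"
proof -
  define V where "V k \<omega> = (noise k \<omega> - noise n \<omega>)\<^sup>2 + 8 / real k" for k \<omega>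
  \<comment> \<open>\<open>W i k\<close> is what \<open>V (Suc k)\<close> becomes when the next
    outcome is \<open>i\<close>.\<close>
  define W where "W i k \<omega> = (noise k \<omega> - noise n \<omega> + r k * (i - f_theta \<theta> (Z k \<omega>)))\<^sup>2 + 8 / real (Suc k)"
    for i k \<omega>
  define B where "B k = (real k + real n + 1)\<^sup>2 + 8" for k
  note [measurable] = measurable_noise_past measurable_Z_past
  have le8: "8 / real k \<le> 8" for k by (cases "k = 0") (auto simp: field_simps)
  have W_bound: "W i k \<omega> \<in> {0..B k}" if "\<omega> \<in> space M" "i \<in> {0, 1}" for i k \<omega>
  proof -
    have "\<bar>r k * (i - f_theta \<theta> (Z k \<omega>))\<bar> \<le> 1"
      using f_range[OF that(1), of k] that(2) r_bounds[of k]
      by (subst abs_mult, intro mult_le_one) auto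
    then have "\<bar>noise k \<omega> - noise n \<omega> + r k * (i - f_theta \<theta> (Z k \<omega>))\<bar> \<le> real k + real n + 1"
      using abs_noise_le[OF that(1), of k] abs_noise_le[OF that(1), of n] by linarith
    then have "(noise k \<omega> - noise n \<omega> + r k * (i - f_theta \<theta> (Z k \<omega>)))\<^sup>2 \<le> (real k + real n + 1)\<^sup>2"
      using power_mono[of "\<bar>noise k \<omega> - noise n \<omega> + r k * (i - f_theta \<theta> (Z k \<omega>))\<bar>" "real k + real n + 1" 2] by simp
    then show ?thesis using le8[of "Suc k"] by (simp add: W_def B_def del: of_nat_Suc)
  qed
  have "\<epsilon>\<^sup>2 * prob {\<omega> \<in> space M. \<exists>k\<ge>n. \<epsilon>\<^sup>2 \<le> V k \<omega>}
      \<le> expectation (\<lambda>\<omega>. indicator (space M) \<omega> * V n \<omega>)"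
  proof (rule adapted_maximal_inequality[where ?V1.0 = "W 1" and ?V0.0 = "W 0" and B = B])
    show "space M \<in> sets (\<F> n)" using sets.top[of "\<F> n"] by simp
    show "V j \<in> borel_measurable (\<F> k)" if "j \<le> k" "n \<le> k" for j k
      using that unfolding V_def by measurable
    show "W 1 k \<in> borel_measurable (\<F> k)" "W 0 k \<in> borel_measurable (\<F> k)" if "n \<le> k" for k
      using that unfolding W_def by measurable
    fix k \<omega> assume \<omega>: "\<omega> \<in> space M"
    show "W 1 k \<omega> \<in> {0..B k}" "W 0 k \<omega> \<in> {0..B k}" using W_bound[OF \<omega>] by auto
    have "(noise k \<omega> - noise n \<omega>)\<^sup>2 \<le> (real k + real n + 1)\<^sup>2"
      using abs_noise_le[OF \<omega>, of k] abs_noise_le[OF \<omega>, of n]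
        power_mono[of "\<bar>noise k \<omega> - noise n \<omega>\<bar>" "real k + real n + 1" 2] by simp
    then show "V k \<omega> \<in> {0..B k}" using le8[of k] by (simp add: V_def B_def)
    assume k: "n \<le> k"
    show "V (Suc k) \<omega> = (if I (Suc k) \<omega> = 1 then W 1 k \<omega> else W 0 k \<omega>)"
      using I_range[OF \<omega>, of k] by (auto simp: V_def W_def noise_def algebra_simps)
    let ?f = "f_theta \<theta> (Z k \<omega>)" and ?s = "noise k \<omega> - noise n \<omega>"
    have "?f * W 1 k \<omega> + (1 - ?f) * W 0 k \<omega> = ?s\<^sup>2 + (r k)\<^sup>2 * (?f * (1 - ?f)) + 8 / real (Suc k)"
    proof -
      have "p * ((s + q * (1 - p))\<^sup>2 + t) + (1 - p) * ((s + q * (0 - p))\<^sup>2 + t)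
          = s\<^sup>2 + q\<^sup>2 * (p * (1 - p)) + t" for p q s t :: real
        by (simp add: algebra_simps power2_eq_square)
      then show ?thesis by (simp only: W_def)
    qed
    also have "\<dots> \<le> ?s\<^sup>2 + (r k)\<^sup>2 * 1 + 8 / real (Suc k)"
      using f_range[OF \<omega>, of k]
      by (intro add_right_mono add_left_mono mult_left_mono mult_le_one) auto
    also have "\<dots> \<le> V k \<omega>" using r[OF k] by (simp add: V_def del: of_nat_Suc)
    finally show "?f * W 1 k \<omega> + (1 - ?f) * W 0 k \<omega> \<le> V k \<omega>" .
  qed simp
  also have "\<dots> = 8 / real n"
  proof -
    have "expectation (\<lambda>\<omega>. indicator (space M) \<omega> * V n \<omega>) = expectation (\<lambda>\<omega>. 8 / real n)"
      by (intro Bochner_Integration.integral_cong) (simp_all add: V_def)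
    then show ?thesis by (simp add: prob_space)
  qed
  finally have "\<epsilon>\<^sup>2 * prob {\<omega> \<in> space M. \<exists>k\<ge>n. \<epsilon>\<^sup>2 \<le> V k \<omega>} \<le> 8 / real n" .
  moreover have "prob {\<omega> \<in> space M. \<exists>k\<ge>n. \<epsilon> \<le> \<bar>noise k \<omega> - noise n \<omega>\<bar>}
      \<le> prob {\<omega> \<in> space M. \<exists>k\<ge>n. \<epsilon>\<^sup>2 \<le> V k \<omega>}"
  proof (rule finite_measure_mono)
    have "\<epsilon>\<^sup>2 \<le> V k \<omega>" if "\<epsilon> \<le> \<bar>noise k \<omega> - noise n \<omega>\<bar>" for k \<omega>
    proof -
      have "\<epsilon>\<^sup>2 \<le> \<bar>noise k \<omega> - noise n \<omega>\<bar>\<^sup>2" using that \<open>0 < \<epsilon>\<close> by (intro power_mono) auto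
      also have "\<dots> \<le> V k \<omega>" by (simp add: V_def)
      finally show ?thesis .
    qed
    then show "{\<omega> \<in> space M. \<exists>k\<ge>n. \<epsilon> \<le> \<bar>noise k \<omega> - noise n \<omega>\<bar>}
        \<subseteq> {\<omega> \<in> space M. \<exists>k\<ge>n. \<epsilon>\<^sup>2 \<le> V k \<omega>}" by blast
    show "{\<omega> \<in> space M. \<exists>k\<ge>n. \<epsilon>\<^sup>2 \<le> V k \<omega>} \<in> events" unfolding V_def by measurable
  qed
  ultimately show ?thesis
    by (meson mult_left_mono order_trans zero_le_power2)
qed

text \<open>Failure of the Cauchy property at scale \<open>\<epsilon>\<close> implies, for every
  large \<open>n\<close>, an excursion after time \<open>n\<close> whose probability is at most
  \<open>8 / (\<epsilon>^2 * n)\<close>; hence it has probability zero.\<close>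

lemma AE_noise_convergent: "AE \<omega> in M. convergent (\<lambda>n. noise n \<omega>)"
proof -
  obtain N where N: "0 < N" "\<And>n. N \<le> n \<Longrightarrow> (r n)\<^sup>2 \<le> 8 / real n - 8 / real (Suc n)"
    using ex_telescoping_start by blast
  have ae: "AE \<omega> in M. \<exists>n. \<forall>k\<ge>n. \<bar>noise k \<omega> - noise n \<omega>\<bar> < \<epsilon>" if "0 < \<epsilon>" for \<epsilon>
  proof -
    let ?B = "{\<omega> \<in> space M. \<forall>n. \<exists>k\<ge>n. \<epsilon> \<le> \<bar>noise k \<omega> - noise n \<omega>\<bar>}"
    have B: "?B \<in> events" by measurable
    have bd: "prob ?B \<le> 8 / \<epsilon>\<^sup>2 * (1 / real n)" if "N \<le> n" for n
    proof -
      have "prob ?B \<le> prob {\<omega> \<in> space M. \<exists>k\<ge>n. \<epsilon> \<le> \<bar>noise k \<omega> - noise n \<omega>\<bar>}"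
        by (intro finite_measure_mono) auto
      moreover have "\<epsilon>\<^sup>2 * prob {\<omega> \<in> space M. \<exists>k\<ge>n. \<epsilon> \<le> \<bar>noise k \<omega> - noise n \<omega>\<bar>} \<le> 8 / real n"
        using that N(2) \<open>0 < \<epsilon>\<close> by (intro noise_tail_bound) auto
      ultimately have "\<epsilon>\<^sup>2 * prob ?B \<le> 8 / real n"
        by (meson mult_left_mono order_trans zero_le_power2)
      then have "prob ?B \<le> 8 / real n / \<epsilon>\<^sup>2"
        using \<open>0 < \<epsilon>\<close> by (subst pos_le_divide_eq) (auto simp: mult.commute)
      then show ?thesis by (simp add: mult.commute)
    qed
    have "prob ?B \<le> 8 / \<epsilon>\<^sup>2 * 0"
      by (rule LIMSEQ_le_const[OF tendsto_mult_left[OF lim_1_over_n]]) (use bd in blast)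
    then have "prob ?B = 0" using measure_nonneg[of M ?B] by simp
    then have "AE \<omega> in M. \<omega> \<notin> ?B" using B prob_eq_0 by blast
    then show ?thesis using AE_space
      by eventually_elim (simp, metis linorder_not_less)
  qed
  have "AE \<omega> in M. \<forall>m. \<exists>n. \<forall>k\<ge>n. \<bar>noise k \<omega> - noise n \<omega>\<bar> < inverse (real (Suc m))"
    by (subst AE_all_countable) (simp add: ae)
  then show ?thesis
  proof eventually_elim
    case (elim \<omega>)
    have "Cauchy (\<lambda>n. noise n \<omega>)" unfolding Cauchy_altdef2
    proof (intro allI impI)
      fix e :: real assume "0 < e"
      then obtain m where m: "inverse (real (Suc m)) < e" using reals_Archimedean by blast
      then show "\<exists>N. \<forall>n\<ge>N. dist (noise n \<omega>) (noise N \<omega>) < e"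
        using elim by (metis dist_real_def order_less_trans)
    qed
    then show ?case by (rule Cauchy_convergent)
  qed
qed

lemma AE_converges_to_fixpoint:
  "AE \<omega> in M. \<exists>z. f_theta \<theta> z = z \<and> (\<lambda>n. Z n \<omega>) \<longlonglongrightarrow> z"
  using AE_noise_convergent AE_space
proof eventually_elim
  case (elim \<omega>)
  have "\<exists>z. f_theta \<theta> z - z = 0 \<and> (\<lambda>n. Z n \<omega>) \<longlonglongrightarrow> z"
  proof (rule perturbed_euler_scheme_converges[where s = "\<lambda>n. noise n \<omega>" and r = r])
    show "Z (Suc n) \<omega> - noise (Suc n) \<omega> = Z n \<omega> - noise n \<omega> + r n * (f_theta \<theta> (Z n \<omega>) - Z n \<omega>)" for n
      using Z_step[OF elim(2), of n] by (simp add: noise_def algebra_simps)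
    show "isCont (\<lambda>z. f_theta \<theta> z - z) y" for y
      unfolding f_theta_def by (intro continuous_intros)
    show "finite {z. f_theta \<theta> z - z = 0}" by (rule finite_f_theta_fixpoints[OF theta(1)])
  qed (use elim Z_range r_bounds tendsto_0_of_n_times_tendsto[OF r_lim]
        not_summable_of_n_times_tendsto_1[OF r_lim] in auto)
  then show ?case by simp
qed

end

section \<open>Instability of the symmetric point\<close>

context majority_process
begin

text \<open>Distance of the two outer fixed points from \<open>1/2\<close> when
  \<open>\<theta> > 5/6\<close>; the radicand is then the positive root in \<open>y^2\<close> of the
  bracket in \<open>f_theta_drift\<close>.\<close>

definition offset :: real where
  "offset = sqrt (3/4 - 1 / (2 * (2*\<theta> - 1)))"

lemma offset_square: "5/6 < \<theta> \<Longrightarrow> offset\<^sup>2 = 3/4 - 1 / (2 * (2*\<theta> - 1))"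
  using theta unfolding offset_def by (subst real_sqrt_pow2) (auto simp: field_simps)

lemma offset_bounds:
  assumes "5/6 < \<theta>"
  shows "0 < offset" "offset < 1/2"
proof -
  show "0 < offset" using assms theta unfolding offset_def by (simp add: field_simps)
  have "offset\<^sup>2 < (1/2)\<^sup>2"
    unfolding offset_square[OF assms] using theta by (simp add: field_simps power2_eq_square)
  then show "offset < 1/2" by (rule power_less_imp_less_base) simp
qed

lemma drift_eq:
  assumes "5/6 < \<theta>"
  shows "f_theta \<theta> z - z = (z - 1/2) * (2 * (2*\<theta> - 1) * (offset\<^sup>2 - (z - 1/2)\<^sup>2))"
  using f_theta_drift[OF theta(1), of "z - 1/2"] by (simp add: offset_square[OF assms])

lemma fixpoint_cases:
  assumes "5/6 < \<theta>" "f_theta \<theta> z = z"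
  shows "z \<in> {1/2, 1/2 + offset, 1/2 - offset}"
proof -
  have "z = 1/2 \<or> (z - 1/2)\<^sup>2 = offset\<^sup>2"
    using f_theta_eq_iff[OF theta(1)] assms offset_square by auto
  then show ?thesis by (auto simp: power2_eq_iff algebra_simps)
qed

text \<open>The sign \<open>\<sigma>\<close> selects one of the two sides of the unstable point \<open>1/2\<close>. The Lyapunov function
  \<open>(max 0 (b - \<sigma> * (Z - 1/2)))^2\<close> only feels the drift between \<open>1/2\<close> and \<open>1/2 + \<sigma> * b\<close>, which points
  away from \<open>1/2\<close>, so that only the noise can bring the process back.\<close>

lemma return_probability_bound:
  assumes \<theta>: "5/6 < \<theta>" and \<sigma>: "\<sigma> \<in> {1, -1}" and b: "0 < b" "b \<le> offset"
    and n: "0 < n" and r: "\<And>k. n \<le> k \<Longrightarrow> (r k)\<^sup>2 \<le> 8 / real k - 8 / real (Suc k)"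
    and E: "E \<in> sets (\<F> n)" "\<And>\<omega>. \<omega> \<in> E \<Longrightarrow> b \<le> \<sigma> * (Z n \<omega> - 1/2)"
  shows "prob {\<omega> \<in> E. \<exists>k\<ge>n. \<sigma> * (Z k \<omega> - 1/2) \<le> b / 2} \<le> 32 / (real n * b\<^sup>2) * prob E"
proof -
  define V where "V k \<omega> = (max 0 (b - \<sigma> * (Z k \<omega> - 1/2)))\<^sup>2 + 8 / real k" for k \<omega>
  define W where "W i k \<omega> = (max 0 (b - \<sigma> * ((1 - r k) * Z k \<omega> + r k * i - 1/2)))\<^sup>2 + 8 / real (Suc k)"
    for i k \<omega>
  define B where "B = (b + 1)\<^sup>2 + 8"
  have abs\<sigma>: "\<bar>\<sigma>\<bar> = 1" and \<sigma>\<sigma>: "\<sigma> * \<sigma> = 1" using \<sigma> by auto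
  note [measurable] = measurable_Z_past
  have le8: "0 \<le> 8 / real k \<and> 8 / real k \<le> 8" for k by (cases "k = 0") (auto simp: field_simps)
  have bound: "(max 0 (b - \<sigma> * (z - 1/2)))\<^sup>2 + 8 / real k \<in> {0..B}" if "0 \<le> z" "z \<le> 1" for z k
  proof -
    have "\<bar>\<sigma> * (z - 1/2)\<bar> = \<bar>z - 1/2\<bar>" by (simp add: abs_mult abs\<sigma>)
    then have "\<bar>\<sigma> * (z - 1/2)\<bar> \<le> 1" using that by linarith
    then have "(max 0 (b - \<sigma> * (z - 1/2)))\<^sup>2 \<le> (b + 1)\<^sup>2" using b by (intro power_mono) auto
    then show ?thesis using le8[of k] by (simp add: B_def)
  qed
  have V_bound: "V k \<omega> \<in> {0..B}" if "\<omega> \<in> space M" for k \<omega>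
    unfolding V_def using Z_range[OF that] by (intro bound) auto
  have W_bound: "W i k \<omega> \<in> {0..B}" if "\<omega> \<in> space M" "i \<in> {0, 1}" for i k \<omega>
    unfolding W_def
  proof (rule bound)
    have "0 \<le> (1 - r k) * Z k \<omega>" "(1 - r k) * Z k \<omega> \<le> (1 - r k) * 1"
      using Z_range[OF that(1), of k] r_bounds[of k]
      by (intro mult_nonneg_nonneg mult_left_mono; simp)+
    then show "0 \<le> (1 - r k) * Z k \<omega> + r k * i" "(1 - r k) * Z k \<omega> + r k * i \<le> 1"
      using that(2) r_bounds[of k] by auto
  qed
  have E_events: "E \<in> events" and E_sub: "E \<subseteq> space M"
    using past_events[OF E(1)] sets.sets_into_space[OF past_events[OF E(1)]] by auto
  \<comment> \<open>A path that comes back to \<open>b/2\<close> has positive part at least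
    \<open>b/2\<close>, hence the level \<open>b^2 / 4\<close>. On \<open>E\<close> the positive
    part vanishes at time \<open>n\<close> and only \<open>8 / n\<close> remains; the quotient is
    the claimed \<open>32 / (n * b^2)\<close>.\<close>
  have "b\<^sup>2 / 4 * prob {\<omega> \<in> E. \<exists>k\<ge>n. b\<^sup>2 / 4 \<le> V k \<omega>} \<le> expectation (\<lambda>\<omega>. indicator E \<omega> * V n \<omega>)"
  proof (rule adapted_maximal_inequality[where ?V1.0 = "W 1" and ?V0.0 = "W 0" and B = "\<lambda>_. B"])
    show "V j \<in> borel_measurable (\<F> k)" if "j \<le> k" "n \<le> k" for j k
      using that unfolding V_def by measurable
    show "W 1 k \<in> borel_measurable (\<F> k)" "W 0 k \<in> borel_measurable (\<F> k)" if "n \<le> k" for k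
      using that unfolding W_def by measurable
    fix k \<omega> assume \<omega>: "\<omega> \<in> space M"
    show "W 1 k \<omega> \<in> {0..B}" "W 0 k \<omega> \<in> {0..B}" using W_bound[OF \<omega>] by auto
    show "V k \<omega> \<in> {0..B}" using V_bound[OF \<omega>] .
    assume k: "n \<le> k"
    show "V (Suc k) \<omega> = (if I (Suc k) \<omega> = 1 then W 1 k \<omega> else W 0 k \<omega>)"
      using I_range[OF \<omega>, of k] Z_step[OF \<omega>, of k] by (auto simp: V_def W_def)
    assume less: "V k \<omega> < b\<^sup>2 / 4"
    define y where "y = \<sigma> * (Z k \<omega> - 1/2)"
    define m where "m = max 0 (b - y)"
    define p where "p = f_theta \<theta> (Z k \<omega>)"
    define d where "d i = r k * (\<sigma> * (i - 1/2) - y)" for i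
    have p: "0 \<le> p" "p \<le> 1" using f_range[OF \<omega>, of k] by (auto simp: p_def)
    have Zy: "Z k \<omega> - 1/2 = \<sigma> * y" using \<sigma>\<sigma> by (simp add: y_def flip: mult.assoc)
    have W_le: "W i k \<omega> \<le> m\<^sup>2 - 2 * m * d i + (r k)\<^sup>2 + 8 / real (Suc k)" if "i \<in> {0, 1}" for i
    proof -
      have "\<sigma> * ((1 - r k) * Z k \<omega> + r k * i - 1/2) = y + d i"
        using \<sigma> by (auto simp: y_def d_def algebra_simps)
      moreover have "(d i)\<^sup>2 \<le> (r k)\<^sup>2"
      proof -
        have "\<bar>\<sigma> * (i - 1/2) - y\<bar> = \<bar>\<sigma>\<bar> * \<bar>i - Z k \<omega>\<bar>"
          unfolding abs_mult[symmetric] by (simp add: y_def algebra_simps)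
        also have "\<dots> \<le> 1" using Z_range[OF \<omega>, of k] that abs\<sigma> by auto
        finally have "\<bar>d i\<bar> \<le> r k"
          using r_bounds[of k] by (simp add: d_def abs_mult mult_left_le)
        then show ?thesis using power_mono[of "\<bar>d i\<bar>" "r k" 2] by simp
      qed
      ultimately show ?thesis
        using square_pos_part_diff_le[of b y "d i"] by (simp add: W_def m_def)
    qed
    \<comment> \<open>Below the level, \<open>m < b/2\<close> forces \<open>y > b/2\<close>, so the
      process is still on the chosen side. If \<open>y \<le> b \<le> offset\<close>, the drift
      points outwards; if \<open>y > b\<close>, the factor \<open>m\<close> is zero.\<close>
    have drift: "0 \<le> m * (p * d 1 + (1 - p) * d 0)"
    proof -
      have "(b/2)\<^sup>2 = b\<^sup>2 / 4" by (simp add: power_divide)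
      then have "m\<^sup>2 < (b/2)\<^sup>2" using less le8[of k] unfolding V_def m_def y_def by linarith
      then have "m < b/2" by (rule power_less_imp_less_base) (use b in simp)
      then have y: "0 < y" using b unfolding m_def by linarith
      have "p * d 1 + (1 - p) * d 0 = r k * (\<sigma> * (p - Z k \<omega>))"
        by (simp add: d_def y_def field_simps)
      also have "p - Z k \<omega> = \<sigma> * y * (2 * (2*\<theta> - 1) * (offset\<^sup>2 - y\<^sup>2))"
        unfolding p_def drift_eq[OF \<theta>] Zy using \<sigma> by (auto simp: power_mult_distrib)
      also have "\<sigma> * \<dots> = y * (2 * (2*\<theta> - 1) * (offset\<^sup>2 - y\<^sup>2))"
        using \<sigma> by auto
      finally have eq: "p * d 1 + (1 - p) * d 0 = r k * (y * (2 * (2*\<theta> - 1) * (offset\<^sup>2 - y\<^sup>2)))" .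
      show ?thesis
      proof (cases "y \<le> b")
        case True
        then have "y\<^sup>2 \<le> offset\<^sup>2" using y b by (intro power_mono) auto
        then show ?thesis unfolding eq
          using r_bounds[of k] y theta by (intro mult_nonneg_nonneg) (auto simp: m_def)
      qed (simp add: m_def)
    qed
    have "p * W 1 k \<omega> + (1 - p) * W 0 k \<omega>
        \<le> p * (m\<^sup>2 - 2 * m * d 1 + (r k)\<^sup>2 + 8 / real (Suc k))
          + (1 - p) * (m\<^sup>2 - 2 * m * d 0 + (r k)\<^sup>2 + 8 / real (Suc k))"
      using W_le p by (intro add_mono mult_left_mono) auto
    also have "\<dots> = m\<^sup>2 - 2 * (m * (p * d 1 + (1 - p) * d 0)) + (r k)\<^sup>2 + 8 / real (Suc k)"
    proof -
      have "p * (m\<^sup>2 - 2 * m * u + q + t) + (1 - p) * (m\<^sup>2 - 2 * m * w + q + t)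
          = m\<^sup>2 - 2 * (m * (p * u + (1 - p) * w)) + q + t" for u w q t :: real
        by (simp add: algebra_simps)
      then show ?thesis .
    qed
    also have "\<dots> \<le> V k \<omega>"
      using drift r[OF k] by (simp add: V_def m_def y_def del: of_nat_Suc)
    finally show "f_theta \<theta> (Z k \<omega>) * W 1 k \<omega> + (1 - f_theta \<theta> (Z k \<omega>)) * W 0 k \<omega> \<le> V k \<omega>"
      by (simp add: p_def)
  qed (use E in auto)
  also have "\<dots> = expectation (\<lambda>\<omega>. 8 / real n * indicator E \<omega>)"
    by (intro Bochner_Integration.integral_cong)
      (use E(2) in \<open>auto simp: V_def indicator_def max_absorb1\<close>)
  also have "\<dots> = 8 / real n * prob E"
    using E_sub by (simp add: Int_absorb2)
  finally have "b\<^sup>2 / 4 * prob {\<omega> \<in> E. \<exists>k\<ge>n. b\<^sup>2 / 4 \<le> V k \<omega>} \<le> 8 / real n * prob E" .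
  moreover have "prob {\<omega> \<in> E. \<exists>k\<ge>n. \<sigma> * (Z k \<omega> - 1/2) \<le> b / 2}
      \<le> prob {\<omega> \<in> E. \<exists>k\<ge>n. b\<^sup>2 / 4 \<le> V k \<omega>}"
  proof (rule finite_measure_mono)
    have "b\<^sup>2 / 4 \<le> V k \<omega>" if "\<sigma> * (Z k \<omega> - 1/2) \<le> b / 2" for k \<omega>
    proof -
      have "(b/2)\<^sup>2 \<le> (max 0 (b - \<sigma> * (Z k \<omega> - 1/2)))\<^sup>2" using that b by (intro power_mono) auto
      moreover have "(b/2)\<^sup>2 = b\<^sup>2 / 4" by (simp add: power_divide)
      ultimately show ?thesis using le8[of k] unfolding V_def by linarith
    qed
    then show "{\<omega> \<in> E. \<exists>k\<ge>n. \<sigma> * (Z k \<omega> - 1/2) \<le> b / 2} \<subseteq> {\<omega> \<in> E. \<exists>k\<ge>n. b\<^sup>2 / 4 \<le> V k \<omega>}"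
      by blast
    have "{\<omega> \<in> space M. \<omega> \<in> E \<and> (\<exists>k\<ge>n. b\<^sup>2 / 4 \<le> V k \<omega>)} \<in> events"
      using E_events unfolding V_def by measurable
    also have "{\<omega> \<in> space M. \<omega> \<in> E \<and> (\<exists>k\<ge>n. b\<^sup>2 / 4 \<le> V k \<omega>)} = {\<omega> \<in> E. \<exists>k\<ge>n. b\<^sup>2 / 4 \<le> V k \<omega>}"
      using E_sub by auto
    finally show "{\<omega> \<in> E. \<exists>k\<ge>n. b\<^sup>2 / 4 \<le> V k \<omega>} \<in> events" .
  qed
  ultimately have "b\<^sup>2 / 4 * prob {\<omega> \<in> E. \<exists>k\<ge>n. \<sigma> * (Z k \<omega> - 1/2) \<le> b / 2} \<le> 8 / real n * prob E"
    by (meson mult_left_mono order_trans zero_le_divide_iff zero_le_numeral zero_le_power2)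
  then show ?thesis using b n by (simp add: field_simps)
qed

lemma expectation_inverse_quadratic_tendsto_0:
  assumes \<theta>: "5/6 < \<theta>"
  shows "(\<lambda>n. expectation (\<lambda>\<omega>. 1 / (1 + 1/288 * real n * (Z n \<omega> - 1/2)\<^sup>2))) \<longlonglongrightarrow> 0"
proof -
  define \<kappa> :: real where "\<kappa> = 1/288"
  \<comment> \<open>A lower bound for the conditional variance \<open>p * (1 - p)\<close>, because
    both factors are at least \<open>1 - \<theta>\<close>.\<close>
  define s where "s = (1 - \<theta>)\<^sup>2"
  have s: "0 < s" using theta by (simp add: s_def)
  define h where "h n z = 1 / (1 + \<kappa> * real n * (z - 1/2)\<^sup>2)" for n and z :: real
  have h: "0 \<le> h n z" "h n z \<le> 1" for n z
  proof -
    have "1 \<le> 1 + \<kappa> * real n * (z - 1/2)\<^sup>2" by (simp add: \<kappa>_def)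
    then show "0 \<le> h n z" "h n z \<le> 1" unfolding h_def by (simp_all add: divide_le_eq)
  qed
  have h_meas[measurable]: "h n \<in> borel_measurable borel" for n unfolding h_def by measurable
  have "(\<lambda>n. real n * r n + r n) \<longlonglongrightarrow> 1 + 0"
    by (intro tendsto_add r_lim tendsto_0_of_n_times_tendsto[OF r_lim])
  then have "\<forall>\<^sub>F n in sequentially. real n * r n + r n < 9/8"
    by (rule order_tendstoD) simp
  moreover have "\<forall>\<^sub>F n in sequentially. 1/2 < real n * r n"
    by (rule order_tendstoD(1)[OF r_lim]) simp
  moreover have "\<forall>\<^sub>F n in sequentially. 8 / (18 * s) \<le> real n"
    by (rule eventually_mono[OF eventually_ge_at_top[of "nat \<lceil>8 / (18 * s)\<rceil>"]]) linarith
  ultimately have "\<forall>\<^sub>F n in sequentially. 1 \<le> n \<and> 8 / (18 * s) \<le> real n \<and> 1/2 \<le> real n * r n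
      \<and> (real n + 1) * r n \<le> 9/8"
    using eventually_ge_at_top[of 1] by eventually_elim (simp add: algebra_simps)
  then obtain N where N: "\<And>n. N \<le> n \<Longrightarrow> 1 \<le> n \<and> 8 / (18 * s) \<le> real n \<and> 1/2 \<le> real n * r n
      \<and> (real n + 1) * r n \<le> 9/8"
    by (auto simp: eventually_sequentially)
  have "(\<lambda>n. expectation (\<lambda>\<omega>. h n (Z n \<omega>))) \<longlonglongrightarrow> 0"
  proof (rule tendsto_0_of_contraction_rate)
    show "0 \<le> expectation (\<lambda>\<omega>. h n (Z n \<omega>))" for n
      by (intro Bochner_Integration.integral_nonneg h)
    show "0 < \<kappa> * s / 8" using s by (simp add: \<kappa>_def)
    fix n assume "N \<le> n"
    note Nn = N[OF this]
    let ?G = "\<lambda>i \<omega>. h (Suc n) ((1 - r n) * Z n \<omega> + r n * i)"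
    have [measurable]: "Z n \<in> borel_measurable (\<F> n)" by (rule measurable_Z_past) simp
    have "expectation (\<lambda>\<omega>. h (Suc n) (Z (Suc n) \<omega>)) \<le> expectation (\<lambda>\<omega>. (1 - \<kappa> * s / 8 / real n) * h n (Z n \<omega>))"
    proof (rule expectation_step_le[where ?G1.0 = "?G 1" and ?G0.0 = "?G 0" and n = n and B = 1])
      show "?G 1 \<in> borel_measurable (\<F> n)" "?G 0 \<in> borel_measurable (\<F> n)" by measurable
      show "\<bar>?G 1 \<omega>\<bar> \<le> 1" "\<bar>?G 0 \<omega>\<bar> \<le> 1" for \<omega> using h by (simp_all add: abs_le_iff)
      show "integrable M (\<lambda>\<omega>. (1 - \<kappa> * s / 8 / real n) * h n (Z n \<omega>))"
        using h by (intro integrable_mult_right bounded_integrable[where B = 1]) (auto simp: abs_le_iff)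
      fix \<omega> assume \<omega>: "\<omega> \<in> space M"
      show "h (Suc n) (Z (Suc n) \<omega>) = (if I (Suc n) \<omega> = 1 then ?G 1 \<omega> else ?G 0 \<omega>)"
        using I_range[OF \<omega>, of n] Z_step[OF \<omega>, of n] by auto
      let ?y = "Z n \<omega> - 1/2" and ?p = "f_theta \<theta> (Z n \<omega>)"
      define w where "w = 2 * (2*\<theta> - 1) * (offset\<^sup>2 - ?y\<^sup>2)"
      have y: "\<bar>?y\<bar> \<le> 1/2" using Z_range[OF \<omega>, of n] by linarith
      have "s \<le> ?p * (1 - ?p)"
        using f_range[OF \<omega>, of n] theta unfolding s_def power2_eq_square by (intro mult_mono) auto
      moreover have "?p - 1/2 - ?y = ?y * w"
        using drift_eq[OF \<theta>, of "Z n \<omega>"] by (simp add: w_def)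
      \<comment> \<open>The minimum is attained at \<open>\<bar>y\<bar> = 1/2\<close> and equals
        \<open>2 * \<theta> - 2\<close>, which exceeds \<open>- 1/3\<close> exactly when
        \<open>\<theta> > 5/6\<close>.\<close>
      moreover have "- 1/3 \<le> w"
      proof -
        have "\<bar>?y\<bar>\<^sup>2 \<le> (1/2)\<^sup>2" using y by (intro power_mono) auto
        then have "2 * (2*\<theta> - 1) * (offset\<^sup>2 - 1/4) \<le> w"
          unfolding w_def using theta by (intro mult_left_mono) (auto simp: power_divide)
        moreover have "2 * (2*\<theta> - 1) * (offset\<^sup>2 - 1/4) = 2 * \<theta> - 2"
          using theta unfolding offset_square[OF \<theta>] by (simp add: field_simps)
        ultimately show ?thesis using \<theta> by linarith
      qed
      ultimately have "?p * (1 / (1 + 1/288 * (real n + 1) * (?y + r n * (1/2 - ?y))\<^sup>2))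
         + (1 - ?p) * (1 / (1 + 1/288 * (real n + 1) * (?y + r n * (- 1/2 - ?y))\<^sup>2))
         \<le> (1 - 1/288 * s / 8 / real n) * (1 / (1 + 1/288 * real n * ?y\<^sup>2))"
        using Nn y s r_bounds[of n] f_range[OF \<omega>, of n]
        by (intro inverse_quadratic_drift) auto
      moreover have "?y + r n * (1/2 - ?y) = (1 - r n) * Z n \<omega> + r n * 1 - 1/2"
        "?y + r n * (- 1/2 - ?y) = (1 - r n) * Z n \<omega> + r n * 0 - 1/2"
        by (simp_all add: field_simps)
      ultimately show "?p * ?G 1 \<omega> + (1 - ?p) * ?G 0 \<omega> \<le> (1 - \<kappa> * s / 8 / real n) * h n (Z n \<omega>)"
        by (simp only: h_def \<kappa>_def of_nat_Suc add.commute)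
    qed
    then show "expectation (\<lambda>\<omega>. h (Suc n) (Z (Suc n) \<omega>))
        \<le> (1 - \<kappa> * s / 8 / real n) * expectation (\<lambda>\<omega>. h n (Z n \<omega>))"
      by simp
  qed
  then show ?thesis by (simp add: h_def \<kappa>_def)
qed

text \<open>Fix \<open>K\<close>. At a late time \<open>n\<close>, a path tending to
  \<open>1/2\<close> is either within \<open>K / sqrt n\<close> of it, which has vanishing
  probability, or has to come back from that distance. With \<open>b = K / sqrt n\<close> the return
  bound is \<open>32 / K^2\<close> on each side, independently of \<open>n\<close>. Sending
  \<open>n\<close> and then \<open>K\<close> to infinity leaves nothing.\<close>

lemma prob_tendsto_half_eq_0:
  assumes \<theta>: "5/6 < \<theta>"
  shows "prob {\<omega> \<in> space M. (\<lambda>n. Z n \<omega>) \<longlonglongrightarrow> 1/2} = 0"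
proof -
  let ?A = "{\<omega> \<in> space M. (\<lambda>n. Z n \<omega>) \<longlonglongrightarrow> 1/2}"
  obtain N where N: "0 < N" "\<And>n. N \<le> n \<Longrightarrow> (r n)\<^sup>2 \<le> 8 / real n - 8 / real (Suc n)"
    using ex_telescoping_start by blast
  let ?e = "\<lambda>n. expectation (\<lambda>\<omega>. 1 / (1 + 1/288 * real n * (Z n \<omega> - 1/2)\<^sup>2))"
  have bound: "prob ?A \<le> 64 / K\<^sup>2" if K: "0 < K" for K :: real
  proof -
    have "(\<lambda>n. K / sqrt (real n)) \<longlonglongrightarrow> 0"
      by (intro tendsto_divide_0[OF tendsto_const] filterlim_at_top_imp_at_infinity
          filterlim_compose[OF sqrt_at_top filterlim_real_sequentially])
    then have "\<forall>\<^sub>F n in sequentially. K / sqrt (real n) < offset"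
      using offset_bounds(1)[OF \<theta>] by (rule order_tendstoD)
    then have ev: "\<forall>\<^sub>F n in sequentially. prob ?A \<le> (1 + 1/288 * K\<^sup>2) * ?e n + 64 / K\<^sup>2"
      using eventually_ge_at_top[of N]
    proof eventually_elim
      case (elim n)
      define b where "b = K / sqrt (real n)"
      have n: "0 < n" using elim N by simp
      have b: "0 < b" "b \<le> offset" using elim K n by (auto simp: b_def)
      have r_le: "(r k)\<^sup>2 \<le> 8 / real k - 8 / real (Suc k)" if "n \<le> k" for k
        using N(2) elim that by (meson order_trans)
      have nb: "real n * b\<^sup>2 = K\<^sup>2" using n by (simp add: b_def power_divide)
      define E where "E \<sigma> = {\<omega> \<in> space M. b \<le> \<sigma> * (Z n \<omega> - 1/2)}" for \<sigma> :: real
      define R where "R \<sigma> = {\<omega> \<in> E \<sigma>. \<exists>k\<ge>n. \<sigma> * (Z k \<omega> - 1/2) \<le> b / 2}" for \<sigma> :: real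
      define C where "C = {\<omega> \<in> space M. \<bar>Z n \<omega> - 1/2\<bar> < b}"
      have R_eq: "R \<sigma> = {\<omega> \<in> space M. b \<le> \<sigma> * (Z n \<omega> - 1/2) \<and> (\<exists>k\<ge>n. \<sigma> * (Z k \<omega> - 1/2) \<le> b / 2)}" for \<sigma>
        by (auto simp: R_def E_def)
      have [measurable]: "R \<sigma> \<in> events" for \<sigma> unfolding R_eq by measurable
      have [measurable]: "C \<in> events" unfolding C_def by measurable
      have R_le: "prob (R \<sigma>) \<le> 32 / K\<^sup>2" if "\<sigma> \<in> {1, -1}" for \<sigma>
      proof -
        have E_past: "E \<sigma> \<in> sets (\<F> n)"
        proof -
          note [measurable] = measurable_Z_past[OF order_refl, of n]
          have "{\<omega> \<in> space (\<F> n). b \<le> \<sigma> * (Z n \<omega> - 1/2)} \<in> sets (\<F> n)" by measurable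
          then show ?thesis by (simp add: E_def)
        qed
        have "prob (R \<sigma>) \<le> 32 / (real n * b\<^sup>2) * prob (E \<sigma>)"
          unfolding R_def
          by (rule return_probability_bound[OF \<theta> that b n r_le E_past]) (simp_all add: E_def)
        also have "\<dots> \<le> 32 / (real n * b\<^sup>2) * 1" by (intro mult_left_mono) auto
        finally show ?thesis by (simp add: nb)
      qed
      have "?A \<subseteq> C \<union> (R 1 \<union> R (-1))"
      proof
        fix \<omega> assume \<omega>: "\<omega> \<in> ?A"
        have "(\<lambda>k. \<bar>Z k \<omega> - 1/2\<bar>) \<longlonglongrightarrow> \<bar>1/2 - 1/2\<bar>"
          using \<omega> by (intro tendsto_intros) auto
        then have "\<forall>\<^sub>F k in sequentially. \<bar>Z k \<omega> - 1/2\<bar> < b / 2"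
          using b by (intro order_tendstoD) auto
        then obtain m where "\<And>k. m \<le> k \<Longrightarrow> \<bar>Z k \<omega> - 1/2\<bar> < b / 2"
          unfolding eventually_sequentially by blast
        then obtain k where k: "n \<le> k" "\<bar>Z k \<omega> - 1/2\<bar> < b / 2"
          using max.cobounded1 max.cobounded2 by blast
        have "1 * (Z k \<omega> - 1/2) \<le> b / 2"
          using k(2) unfolding mult_1 by linarith
        moreover have "-1 * (Z k \<omega> - 1/2) \<le> b / 2"
          using k(2) unfolding mult_minus1 by linarith
        ultimately show "\<omega> \<in> C \<union> (R 1 \<union> R (-1))"
          using \<omega> k(1) unfolding C_def R_eq by (auto simp: abs_less_iff not_less)
      qed
      then have "prob ?A \<le> prob (C \<union> (R 1 \<union> R (-1)))" by (intro finite_measure_mono) auto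
      also have "\<dots> \<le> prob C + (prob (R 1) + prob (R (-1)))"
        using measure_Un_le[of C M "R 1 \<union> R (-1)"] measure_Un_le[of "R 1" M "R (-1)"] by simp
      \<comment> \<open>Markov's inequality: on \<open>C\<close> the test function is at least
        \<open>1 / (1 + K^2 / 288)\<close>.\<close>
      also have "prob C \<le> (1 + 1/288 * K\<^sup>2) * ?e n"
      proof -
        let ?h = "\<lambda>\<omega>. 1 / (1 + 1/288 * real n * (Z n \<omega> - 1/2)\<^sup>2)"
        have h1: "1 \<le> 1 + 1/288 * real n * (Z n \<omega> - 1/2)\<^sup>2" for \<omega> by simp
        have int: "integrable M ?h"
          using h1 by (intro bounded_integrable[where B = 1]) (auto simp: abs_le_iff divide_le_eq)
        have "prob C = expectation (indicator C)" by (simp add: C_def)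
        also have "\<dots> \<le> expectation (\<lambda>\<omega>. (1 + 1/288 * K\<^sup>2) * ?h \<omega>)"
        proof (rule integral_mono)
          show "integrable M (indicator C :: 'a \<Rightarrow> real)"
            by (intro integrable_real_indicator) (auto simp: less_top[symmetric])
          show "integrable M (\<lambda>\<omega>. (1 + 1/288 * K\<^sup>2) * ?h \<omega>)"
            using int by (rule integrable_mult_right)
          fix \<omega>
          show "indicator C \<omega> \<le> (1 + 1/288 * K\<^sup>2) * ?h \<omega>"
          proof (cases "\<omega> \<in> C")
            case True
            then have "\<bar>Z n \<omega> - 1/2\<bar>\<^sup>2 \<le> b\<^sup>2" by (intro power_mono) (auto simp: C_def)
            then have "real n * (Z n \<omega> - 1/2)\<^sup>2 \<le> K\<^sup>2"
              unfolding nb[symmetric] by (intro mult_left_mono) auto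
            then have "1 + 1/288 * real n * (Z n \<omega> - 1/2)\<^sup>2 \<le> 1 + 1/288 * K\<^sup>2" by simp
            then have "1 \<le> (1 + 1/288 * K\<^sup>2) / (1 + 1/288 * real n * (Z n \<omega> - 1/2)\<^sup>2)"
              using h1[of \<omega>] by (subst le_divide_eq_1_pos) linarith+
            then show ?thesis using True by simp
          next
            case False
            have "0 \<le> ?h \<omega>" using h1[of \<omega>] by simp
            then show ?thesis using False by simp
          qed
        qed
        finally show ?thesis by (simp only: integral_mult_right_zero)
      qed
      finally show ?case using R_le[of 1] R_le[of "-1"] by simp
    qed
    have "(\<lambda>n. (1 + 1/288 * K\<^sup>2) * ?e n + 64 / K\<^sup>2) \<longlonglongrightarrow> (1 + 1/288 * K\<^sup>2) * 0 + 64 / K\<^sup>2"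
      by (intro tendsto_intros expectation_inverse_quadratic_tendsto_0[OF \<theta>])
    then have "prob ?A \<le> (1 + 1/288 * K\<^sup>2) * 0 + 64 / K\<^sup>2"
      by (rule tendsto_lowerbound[OF _ ev]) simp
    then show ?thesis by simp
  qed
  have "(\<lambda>n. 64 * (1 / real n) ^ 2) \<longlonglongrightarrow> 64 * 0 ^ 2"
    by (intro tendsto_intros lim_1_over_n)
  then have "(\<lambda>n. 64 / (real n)\<^sup>2) \<longlonglongrightarrow> 0" by (simp add: power_divide)
  then have "prob ?A \<le> 0"
    by (rule LIMSEQ_le_const) (intro exI[of _ 1] allI impI bound, simp)
  then show ?thesis using measure_nonneg[of M ?A] by linarith
qed

text \<open>Whatever the past, the next outcome is \<open>i\<close> with conditional probability at
  least \<open>1 - \<theta>\<close>, so each step costs at most this factor. Membership in the past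
  at time \<open>n\<close> makes the run a legitimate starting event for the return bound.\<close>

lemma prob_constant_start_pos:
  fixes n :: nat
  assumes i: "i \<in> {0, 1}"
  defines "E \<equiv> \<lambda>n. {\<omega> \<in> space M. \<forall>k\<in>{1..n}. I k \<omega> = i}"
  shows "E n \<in> sets (\<F> n)" "0 < prob (E n)"
proof -
  have E_past: "E n \<in> sets (\<F> n)" for n
  proof -
    have "{\<omega> \<in> space (\<F> n). \<forall>k\<in>{1..n}. I k \<omega> = i} \<in> sets (\<F> n)"
      using measurable_I_past by (intro sets.sets_Collect_finite_All borel_measurable_eq) auto
    then show ?thesis by (simp add: E_def)
  qed
  then show "E n \<in> sets (\<F> n)" .
  have E_events[measurable]: "E n \<in> events" for n using past_events[OF E_past] .
  have E_sub: "E n \<subseteq> space M" for n by (auto simp: E_def)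
  have E_Suc: "E (Suc n) = {\<omega> \<in> E n. I (Suc n) \<omega> = i}" for n
  proof -
    have "{1..Suc n} = insert (Suc n) {1..n}" by auto
    then show ?thesis unfolding E_def by auto
  qed
  show "0 < prob (E n)"
  proof (induction n)
    case 0
    have "E 0 = space M" by (simp add: E_def)
    then show ?case by (simp add: prob_space)
  next
    case (Suc n)
    let ?G = "\<lambda>j \<omega>. if i = j then indicator (E n) \<omega> else 0 :: real"
    let ?H = "\<lambda>\<omega>. f_theta \<theta> (Z n \<omega>) * ?G 1 \<omega> + (1 - f_theta \<theta> (Z n \<omega>)) * ?G 0 \<omega>"
    have ind: "(\<lambda>\<omega>. indicator (E n) \<omega> :: real) \<in> borel_measurable (\<F> n)"
      using E_past by (rule borel_measurable_indicator)
    have "(1 - \<theta>) * prob (E n) = expectation (\<lambda>\<omega>. (1 - \<theta>) * indicator (E n) \<omega>)"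
      by (simp add: Int_absorb2 E_sub)
    also have "\<dots> \<le> expectation ?H"
    proof (rule integral_mono)
      show "integrable M (\<lambda>\<omega>. (1 - \<theta>) * indicator (E n) \<omega> :: real)"
        using theta by (intro bounded_integrable[where B = 1]) (auto simp: indicator_def)
      show "integrable M ?H"
      proof (rule bounded_integrable[where B = 1])
        show "\<bar>?H \<omega>\<bar> \<le> 1" if "\<omega> \<in> space M" for \<omega>
          using f_range[OF that, of n] by (auto simp: indicator_def)
      qed measurable
      show "(1 - \<theta>) * indicator (E n) \<omega> \<le> ?H \<omega>" if "\<omega> \<in> space M" for \<omega>
        using f_range[OF that, of n] i by (auto simp: indicator_def)
    qed
    also have "\<dots> = expectation (\<lambda>\<omega>. if I (Suc n) \<omega> = 1 then ?G 1 \<omega> else ?G 0 \<omega>)"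
    proof (rule expectation_step[symmetric, where B = 1])
      show "?G 1 \<in> borel_measurable (\<F> n)" "?G 0 \<in> borel_measurable (\<F> n)"
        using ind by (cases "i = 1"; cases "i = 0"; simp)+
    qed (simp_all add: indicator_def)
    also have "\<dots> = expectation (indicator (E (Suc n)))"
    proof (rule Bochner_Integration.integral_cong)
      show "(if I (Suc n) \<omega> = 1 then ?G 1 \<omega> else ?G 0 \<omega>) = indicator (E (Suc n)) \<omega>"
        if "\<omega> \<in> space M" for \<omega>
        using I_range[OF that, of n] i by (auto simp: E_Suc indicator_def)
    qed simp
    also have "\<dots> = prob (E (Suc n))" by (simp add: Int_absorb2 E_sub)
    finally have "(1 - \<theta>) * prob (E n) \<le> prob (E (Suc n))" .
    moreover have "0 < (1 - \<theta>) * prob (E n)" using Suc theta by simp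
    ultimately show ?case by linarith
  qed
qed

text \<open>The starting event may have tiny probability, depending on the chosen \<open>n\<close>.
  This is harmless because the return bound carries the factor \<open>prob E\<close>: it suffices
  that its other factor is below \<open>1\<close>, so \<open>n\<close> can be fixed
  beforehand.\<close>

lemma prob_tendsto_stable_pos:
  assumes \<theta>: "5/6 < \<theta>" and \<sigma>: "\<sigma> \<in> {1, -1}"
  shows "0 < prob {\<omega> \<in> space M. (\<lambda>n. Z n \<omega>) \<longlonglongrightarrow> 1/2 + \<sigma> * offset}"
proof -
  note off = offset_bounds[OF \<theta>]
  obtain N where N: "0 < N" "\<And>n. N \<le> n \<Longrightarrow> (r n)\<^sup>2 \<le> 8 / real n - 8 / real (Suc n)"
    using ex_telescoping_start by blast
  \<comment> \<open>\<open>d n\<close> is the product of \<open>1 - r k\<close> over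
    \<open>k < n\<close>, the factor by which a run of equal outcomes shrinks the distance to the
    end point. It vanishes in the limit by the convergence result for Euler schemes, with drift
    \<open>- y\<close> and no perturbation.\<close>
  define d where "d = rec_nat (1::real) (\<lambda>n x. (1 - r n) * x)"
  have d_simps: "d 0 = 1" "d (Suc n) = (1 - r n) * d n" for n by (simp_all add: d_def)
  have d_range: "0 \<le> d n \<and> d n \<le> 1" for n
    by (induction n) (use r_bounds in \<open>auto simp: d_simps intro: mult_le_one\<close>)
  have "\<exists>z. - z = 0 \<and> d \<longlonglongrightarrow> z"
    by (rule perturbed_euler_scheme_converges[where s = "\<lambda>_. 0" and r = r])
      (use d_range r_bounds tendsto_0_of_n_times_tendsto[OF r_lim] not_summable_of_n_times_tendsto_1[OF r_lim]
        in \<open>auto simp: d_simps algebra_simps intro: convergent_const\<close>)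
  then have "d \<longlonglongrightarrow> 0" by simp
  then have ev1: "\<forall>\<^sub>F n in sequentially. d n < 1/2 - offset"
    using off by (intro order_tendstoD) auto
  have "(\<lambda>n. 32 / offset\<^sup>2 * (1 / real n)) \<longlonglongrightarrow> 32 / offset\<^sup>2 * 0"
    by (intro tendsto_intros lim_1_over_n)
  then have ev2: "\<forall>\<^sub>F n in sequentially. 32 / offset\<^sup>2 * (1 / real n) < 1"
    by (intro order_tendstoD) auto
  have "\<exists>n. d n < 1/2 - offset \<and> 32 / offset\<^sup>2 * (1 / real n) < 1 \<and> N \<le> n"
    using eventually_conj[OF ev1 eventually_conj[OF ev2 eventually_ge_at_top[of N]]]
    by (rule eventually_happens'[rotated]) simp
  then obtain n where n: "d n < 1/2 - offset" "32 / offset\<^sup>2 * (1 / real n) < 1" "N \<le> n" by blast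
  \<comment> \<open>The end point of \<open>[0,1]\<close> on the side \<open>\<sigma>\<close>; the
    distance from \<open>z\<close> to it is \<open>1/2 - \<sigma> * (z - 1/2)\<close>.\<close>
  define i where "i = (1 + \<sigma>) / 2"
  have i: "i \<in> {0, 1}" using \<sigma> by (auto simp: i_def)
  define E where "E = {\<omega> \<in> space M. \<forall>k\<in>{1..n}. I k \<omega> = i}"
  have E: "E \<in> sets (\<F> n)" "0 < prob E" using prob_constant_start_pos[OF i, of n] by (auto simp: E_def)
  have E_start: "offset \<le> \<sigma> * (Z n \<omega> - 1/2)" if "\<omega> \<in> E" for \<omega>
  proof -
    have \<omega>: "\<omega> \<in> space M" using that by (simp add: E_def)
    have "1/2 - \<sigma> * (Z k \<omega> - 1/2) \<le> d k" if "k \<le> n" for k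
      using that
    proof (induction k)
      case 0
      show ?case using Z_range[OF \<omega>, of 0] \<sigma> by (auto simp: d_simps)
    next
      case (Suc k)
      have "I (Suc k) \<omega> = i" using \<open>\<omega> \<in> E\<close> Suc.prems by (simp add: E_def)
      then have "1/2 - \<sigma> * (Z (Suc k) \<omega> - 1/2) = (1 - r k) * (1/2 - \<sigma> * (Z k \<omega> - 1/2))"
        using Z_step[OF \<omega>, of k] \<sigma> by (auto simp: i_def field_simps)
      also have "\<dots> \<le> (1 - r k) * d k" using Suc r_bounds[of k] by (intro mult_left_mono) auto
      finally show ?case by (simp add: d_simps)
    qed
    from this[of n] show ?thesis using n by simp
  qed
  define R where "R = {\<omega> \<in> E. \<exists>k\<ge>n. \<sigma> * (Z k \<omega> - 1/2) \<le> offset / 2}"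
  have E_events[measurable]: "E \<in> events" using past_events[OF E(1)] .
  have "R = {\<omega> \<in> space M. \<omega> \<in> E \<and> (\<exists>k\<ge>n. \<sigma> * (Z k \<omega> - 1/2) \<le> offset / 2)}"
    by (auto simp: R_def E_def)
  then have R_events[measurable]: "R \<in> events" by simp
  have "prob R \<le> 32 / (real n * offset\<^sup>2) * prob E"
    unfolding R_def using \<theta> \<sigma> off N n(3) E E_start by (intro return_probability_bound) auto
  also have "\<dots> < 1 * prob E"
    using n(2) E(2) by (intro mult_strict_right_mono) (auto simp: mult.commute)
  finally have "0 < prob E - prob R" by simp
  also have "\<dots> = prob (E - R)"
    by (rule finite_measure_Diff[symmetric]) (auto simp: R_def)
  also have "\<dots> \<le> prob {\<omega> \<in> space M. (\<lambda>n. Z n \<omega>) \<longlonglongrightarrow> 1/2 + \<sigma> * offset}"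
  proof (rule finite_measure_mono_AE)
    show "AE \<omega> in M. \<omega> \<in> E - R \<longrightarrow> \<omega> \<in> {\<omega> \<in> space M. (\<lambda>n. Z n \<omega>) \<longlonglongrightarrow> 1/2 + \<sigma> * offset}"
      using AE_converges_to_fixpoint AE_space
    proof eventually_elim
      case (elim \<omega>)
      show ?case
      proof
        assume \<omega>: "\<omega> \<in> E - R"
        obtain z where z: "f_theta \<theta> z = z" "(\<lambda>n. Z n \<omega>) \<longlonglongrightarrow> z" using elim by blast
        have "(\<lambda>k. \<sigma> * (Z k \<omega> - 1/2)) \<longlonglongrightarrow> \<sigma> * (z - 1/2)" using z by (intro tendsto_intros)
        moreover have "\<forall>k\<ge>n. offset / 2 \<le> \<sigma> * (Z k \<omega> - 1/2)" using \<omega> by (auto simp: R_def)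
        ultimately have "offset / 2 \<le> \<sigma> * (z - 1/2)" by (intro LIMSEQ_le_const) auto
        \<comment> \<open>Staying beyond \<open>offset / 2\<close> on the side
          \<open>\<sigma>\<close> excludes \<open>1/2\<close> and the opposite fixed point.\<close>
        then have "z = 1/2 + \<sigma> * offset"
          using fixpoint_cases[OF \<theta> z(1)] \<sigma> off by auto
        then show "\<omega> \<in> {\<omega> \<in> space M. (\<lambda>n. Z n \<omega>) \<longlonglongrightarrow> 1/2 + \<sigma> * offset}" using z elim by simp
      qed
    qed
    show "{\<omega> \<in> space M. (\<lambda>n. Z n \<omega>) \<longlonglongrightarrow> 1/2 + \<sigma> * offset} \<in> events" by measurable
  qed
  finally show ?thesis .
qed

lemma AE_converges_to_stable:
  assumes \<theta>: "5/6 < \<theta>"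
  shows "AE \<omega> in M. (\<lambda>n. Z n \<omega>) \<longlonglongrightarrow> 1/2 - offset \<or> (\<lambda>n. Z n \<omega>) \<longlonglongrightarrow> 1/2 + offset"
proof -
  have "{\<omega> \<in> space M. (\<lambda>n. Z n \<omega>) \<longlonglongrightarrow> 1/2} \<in> events" by measurable
  then have "AE \<omega> in M. \<omega> \<notin> {\<omega> \<in> space M. (\<lambda>n. Z n \<omega>) \<longlonglongrightarrow> 1/2}"
    using prob_tendsto_half_eq_0[OF \<theta>] prob_eq_0 by blast
  with AE_converges_to_fixpoint AE_space show ?thesis
  proof eventually_elim
    case (elim \<omega>)
    then obtain z where z: "f_theta \<theta> z = z" "(\<lambda>n. Z n \<omega>) \<longlonglongrightarrow> z" by blast
    then have "z \<noteq> 1/2" using elim by blast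
    then have "z = 1/2 - offset \<or> z = 1/2 + offset" using fixpoint_cases[OF \<theta> z(1)] by blast
    then show ?case using z(2) by blast
  qed
qed

lemma AE_converges_to_half:
  assumes \<theta>: "\<theta> \<le> 5/6"
  shows "AE \<omega> in M. (\<lambda>n. Z n \<omega>) \<longlonglongrightarrow> 1/2"
  using AE_converges_to_fixpoint
proof eventually_elim
  case (elim \<omega>)
  then obtain z where z: "f_theta \<theta> z = z" "(\<lambda>n. Z n \<omega>) \<longlonglongrightarrow> z" by blast
  have le: "3/4 - 1 / (2 * (2*\<theta> - 1)) \<le> 0" using theta \<theta> by (simp add: field_simps)
  have "z = 1/2"
    using z(1)[unfolded f_theta_eq_iff[OF theta(1)]]
  proof
    assume "(z - 1/2)\<^sup>2 = 3/4 - 1 / (2 * (2*\<theta> - 1))"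
    then have "(z - 1/2)\<^sup>2 \<le> 0" using le by linarith
    then show ?thesis by simp
  qed
  then show ?case using z(2) by blast
qed

text \<open>By uniqueness of limits, no point outside \<open>L\<close> is a limit with positive
  probability. Besides identifying the configurations, the case of a singleton \<open>L\<close>
  shows that predictability would leave only one of them.\<close>

lemma limit_configurations_eq:
  assumes "AE \<omega> in M. \<exists>z\<in>L. (\<lambda>n. Z n \<omega>) \<longlonglongrightarrow> z"
    and "\<And>z. z \<in> L \<Longrightarrow> 0 < prob {\<omega> \<in> space M. (\<lambda>n. Z n \<omega>) \<longlonglongrightarrow> z}"
  shows "limit_configurations M Z = L"
proof -
  have "prob {\<omega> \<in> space M. (\<lambda>n. Z n \<omega>) \<longlonglongrightarrow> z} = 0" if "z \<notin> L" for z
  proof -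
    have ev: "{\<omega> \<in> space M. (\<lambda>n. Z n \<omega>) \<longlonglongrightarrow> z} \<in> events" by measurable
    have "AE \<omega> in M. \<omega> \<notin> {\<omega> \<in> space M. (\<lambda>n. Z n \<omega>) \<longlonglongrightarrow> z}"
      using assms(1) by eventually_elim (use that LIMSEQ_unique in blast)
    then show ?thesis using prob_eq_0[OF ev] by blast
  qed
  then show ?thesis using assms(2) unfolding limit_configurations_def by force
qed

end

section \<open>Solutions of \<open>f' = 1\<close> and the final statement\<close>

lemma deriv_f_theta: "deriv (f_theta \<theta>) x = (2 * \<theta> - 1) * (6 * x - 6 * x\<^sup>2)"
  unfolding f_theta_def
  by (rule DERIV_imp_deriv) (auto intro!: derivative_eq_intros simp: algebra_simps power2_eq_square)

lemma deriv_f_theta_eq_1: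
  fixes \<theta> :: real
  assumes "5/6 < \<theta>"
  defines "v \<equiv> sqrt (1/4 - 1 / (6 * (2*\<theta> - 1)))"
  shows "{x \<in> {0<..<1}. deriv (f_theta \<theta>) x = 1} = {1/2 - v, 1/2 + v}" "0 < v" "v < 1/2"
proof -
  have v2: "v\<^sup>2 = 1/4 - 1 / (6 * (2*\<theta> - 1))"
    unfolding v_def using assms(1) by (subst real_sqrt_pow2) (auto simp: field_simps)
  show "0 < v" unfolding v_def using assms(1) by (simp add: field_simps)
  have "v\<^sup>2 < (1/2)\<^sup>2" unfolding v2 using assms(1) by (simp add: power_divide)
  then show "v < 1/2" by (rule power_less_imp_less_base) simp
  have "deriv (f_theta \<theta>) x = 1 \<longleftrightarrow> x = 1/2 - v \<or> x = 1/2 + v" for x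
  proof -
    have "deriv (f_theta \<theta>) x - 1 = 6 * (2 * \<theta> - 1) * (v\<^sup>2 - (x - 1/2)\<^sup>2)"
      unfolding deriv_f_theta v2 using assms(1) by (simp add: field_simps power2_eq_square)
    then have "deriv (f_theta \<theta>) x = 1 \<longleftrightarrow> (x - 1/2)\<^sup>2 = v\<^sup>2" using assms(1) by auto
    then show ?thesis by (auto simp: power2_eq_iff algebra_simps)
  qed
  then show "{x \<in> {0<..<1}. deriv (f_theta \<theta>) x = 1} = {1/2 - v, 1/2 + v}"
    using \<open>0 < v\<close> \<open>v < 1/2\<close> by auto
qed

theorem mainTheorem10:
  fixes M :: "'a measure"
    and r :: "nat \<Rightarrow> real"
    and Z I :: "nat \<Rightarrow> 'a \<Rightarrow> real"
    and \<theta> :: real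
  assumes "1/2 < \<theta>" and "\<theta> < 1"
    and "single_unit_process M r (f_theta \<theta>) Z I"
  shows "(\<theta> \<le> 5/6 \<longrightarrow>
           predictable M Z \<and> limit_configurations M Z = {1/2} \<and>
           (AE \<omega> in M. (\<lambda>n. Z n \<omega>) \<longlonglongrightarrow> 1/2)) \<and>
         (5/6 < \<theta> \<longrightarrow>
           (AE \<omega> in M. convergent (\<lambda>n. Z n \<omega>)) \<and>
           \<not> predictable M Z \<and>
           (\<exists>z1 z2 x1 x2.
              limit_configurations M Z = {z1, z2} \<and>
              (AE \<omega> in M. lim (\<lambda>n. Z n \<omega>) \<in> {z1, z2}) \<and>
              {z1, z2} \<subseteq> {0<..<1} - {1/2} \<and>
              {x \<in> {0<..<1}. deriv (f_theta \<theta>) x = 1} = {x1, x2} \<and>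
              0 < z1 \<and> z1 < x1 \<and> x1 < 1/2 \<and>
              1/2 < x2 \<and> x2 = 1 - x1 \<and> x2 < z2 \<and> z2 = 1 - z1 \<and> z2 < 1))"
proof -
  interpret majority_process M r \<theta> Z I
    using assms by (intro majority_process.intro majority_process_axioms.intro)
  show ?thesis
  proof (intro conjI impI)
    assume \<theta>: "\<theta> \<le> 5/6"
    show half: "AE \<omega> in M. (\<lambda>n. Z n \<omega>) \<longlonglongrightarrow> 1/2" by (rule AE_converges_to_half[OF \<theta>])
    then show "predictable M Z" unfolding predictable_def by blast
    show "limit_configurations M Z = {1/2}"
    proof (rule limit_configurations_eq)
      show "AE \<omega> in M. \<exists>z\<in>{1/2}. (\<lambda>n. Z n \<omega>) \<longlonglongrightarrow> z" using half by simp
      have "prob {\<omega> \<in> space M. (\<lambda>n. Z n \<omega>) \<longlonglongrightarrow> 1/2} = 1"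
        using half by (subst prob_Collect_eq_1) auto
      then have "0 < prob {\<omega> \<in> space M. (\<lambda>n. Z n \<omega>) \<longlonglongrightarrow> 1/2}" by linarith
      then show "0 < prob {\<omega> \<in> space M. (\<lambda>n. Z n \<omega>) \<longlonglongrightarrow> z}" if "z \<in> {1/2}" for z
        using that by blast
    qed
  next
    assume \<theta>: "5/6 < \<theta>"
    let ?z1 = "1/2 - offset" and ?z2 = "1/2 + offset"
    define v where "v = sqrt (1/4 - 1 / (6 * (2*\<theta> - 1)))"
    note v = deriv_f_theta_eq_1[OF \<theta>, folded v_def]
    note off = offset_bounds[OF \<theta>]
    have ae: "AE \<omega> in M. (\<lambda>n. Z n \<omega>) \<longlonglongrightarrow> ?z1 \<or> (\<lambda>n. Z n \<omega>) \<longlonglongrightarrow> ?z2"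
      by (rule AE_converges_to_stable[OF \<theta>])
    show "AE \<omega> in M. convergent (\<lambda>n. Z n \<omega>)"
      using ae by eventually_elim (auto simp: convergent_def)
    have config: "limit_configurations M Z = {?z1, ?z2}"
    proof (rule limit_configurations_eq)
      show "AE \<omega> in M. \<exists>z\<in>{?z1, ?z2}. (\<lambda>n. Z n \<omega>) \<longlonglongrightarrow> z" using ae by simp
      show "0 < prob {\<omega> \<in> space M. (\<lambda>n. Z n \<omega>) \<longlonglongrightarrow> z}" if "z \<in> {?z1, ?z2}" for z
        using that prob_tendsto_stable_pos[OF \<theta>, of 1] prob_tendsto_stable_pos[OF \<theta>, of "-1"] by auto
    qed
    show "\<not> predictable M Z"
    proof
      assume "predictable M Z"
      then obtain z where "AE \<omega> in M. (\<lambda>n. Z n \<omega>) \<longlonglongrightarrow> z" unfolding predictable_def by blast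
      moreover from this have "prob {\<omega> \<in> space M. (\<lambda>n. Z n \<omega>) \<longlonglongrightarrow> z} = 1"
        by (subst prob_Collect_eq_1) auto
      ultimately have "limit_configurations M Z = {z}" by (intro limit_configurations_eq) auto
      then have "{?z1, ?z2} = {z}" unfolding config .
      then have "?z1 = ?z2" by (metis insertI1 insertI2 singletonD)
      then show False using off by simp
    qed
    \<comment> \<open>The centred drift is a multiple of \<open>y * (offset^2 - y^2)\<close>, whose
      critical points satisfy \<open>y^2 = offset^2 / 3\<close>; so the solutions of
      \<open>f' = 1\<close> lie strictly between \<open>1/2\<close> and the stable points.\<close>
    have "offset\<^sup>2 = 3 * v\<^sup>2"
      unfolding offset_square[OF \<theta>] v_def using \<theta> by (subst real_sqrt_pow2) (auto simp: field_simps)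
    then have "v\<^sup>2 < offset\<^sup>2" using v(2) by simp
    then have "v < offset" by (rule power_less_imp_less_base) (use off in simp)
    moreover have "AE \<omega> in M. lim (\<lambda>n. Z n \<omega>) \<in> {?z1, ?z2}"
      using ae by eventually_elim (auto dest: limI)
    ultimately show "\<exists>z1 z2 x1 x2.
              limit_configurations M Z = {z1, z2} \<and>
              (AE \<omega> in M. lim (\<lambda>n. Z n \<omega>) \<in> {z1, z2}) \<and>
              {z1, z2} \<subseteq> {0<..<1} - {1/2} \<and>
              {x \<in> {0<..<1}. deriv (f_theta \<theta>) x = 1} = {x1, x2} \<and>
              0 < z1 \<and> z1 < x1 \<and> x1 < 1/2 \<and>
              1/2 < x2 \<and> x2 = 1 - x1 \<and> x2 < z2 \<and> z2 = 1 - z1 \<and> z2 < 1"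
      using config v off
      by (intro exI[of _ ?z1] exI[of _ ?z2] exI[of _ "1/2 - v"] exI[of _ "1/2 + v"]) auto
  qed
qed

end
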